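(* Let $(\mathbf X,k),(\mathbf X_1,k_1),\dots,(\mathbf X_n,k_n)$ be labelled $d\times d$ images generated from template functions $f_0,f_1$ by deformations in a class $\mathcal A$ according to the general deformation model (see context). Suppose that both labels occur in the training data, that is, $\{i\in\{1,\dots,n\}:k_i=0\}\neq\varnothing$ and $\{i\in\{1,\dots,n\}:k_i=1\}\neq\varnothing$. Assume that $f_0,f_1$ satisfy Assumption 1 of the context with Lipschitz constant $C_L$, and that $\mathcal A$ satisfies Assumption 2 of the context with constants $C_{\mathcal A},C_{\mathcal J}$. Let $\mathcal A_d^{-1}$ be a $1/d$-covering of $\mathcal A^{-1}$ on the domain $D_{\mathcal A}=[-2C_{\mathcal A}-1,2C_{\mathcal A}+1]^2$. There is a sufficiently large constant $C(C_L,C_{\mathcal A},C_{\mathcal J})$, depending only on $C_L,C_{\mathcal A},C_{\mathcal J}$, such that if $$D>\frac{C(C_L,C_{\mathcal A},C_{\mathcal J})}{d},$$ then the inverse mapping classifier $\widehat k$ satisfies $\widehat k=k$.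
   Context: Notation: $\|\cdot\|_p$ is the $L^p$-norm on $[0,1]^2$; $x\vee y=\max\{x,y\}$. The support of a function $g$ is $\{x:g(x)\neq0\}$. For $d\ge1$ and $j,\ell\in\mathbb Z$ let $I_{j,\ell}=[\frac{j-1}d,\frac jd)\times[\frac{\ell-1}d,\frac\ell d)$. General deformation model: $f_0,f_1:\mathbb R^2\to[0,\infty)$ are template functions, not identically zero; $\mathcal A$ is a class of invertible maps $A=(a_1,a_2):\mathbb R^2\to\mathbb R^2$. An image with label $k\in\{0,1\}$, deformation $A\in\mathcal A$ and brightness $\eta>0$ is the matrix $\mathbf X=(X_{j,\ell})_{j,\ell=1,\dots,d}$ with $X_{j,\ell}=d^2\eta\int_{I_{j,\ell}}f_k(A(u,v))\,du\,dv$. Each $(\mathbf X_i,k_i)$ is generated in this way with its own $A_i\in\mathcal A$, $\eta_i>0$ and label $k_i$; likewise $(\mathbf X,k)$ with some $A\in\mathcal A$, $\eta>0$. Assumption 1: The supports of $f_0,f_1$ are contained in a rectangle $[\beta_{\mathrm{left}},\beta_{\mathrm{right}}]\times[\beta_{\mathrm{down}},\beta_{\mathrm{up}}]\subseteq[0,1]^2$, and there is a constant $C_L>0$ such that for all real $u,v,u',v'$ and $k=0,1$: $|f_k(u,v)-f_k(u',v')|\le C_L\|f_k\|_1(|u-u'|+|v-v'|)$. Assumption 2: (i) $\mathcal A$ contains the identity; for every $A=(a_1,a_2)\in\mathcal A$, $[\beta_{\mathrm{left}},\beta_{\mathrm{right}}]\times[\beta_{\mathrm{down}},\beta_{\mathrm{up}}]\subseteq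 A([0,1]^2)$, and $a_1,a_2$ have continuous partial derivatives on $\mathbb R^2$ bounded in supremum norm by a constant $C_{\mathcal A}$. (ii) $C_{\mathcal J}^2:=\inf_{A\in\mathcal A}\inf_{(u,v)\in\mathbb R^2}|\det J_A(u,v)|>0$ (with $C_{\mathcal J}>0$), where $J_A$ is the Jacobian matrix of $A$. Covering: $\mathcal A^{-1}=\{A^{-1}:A\in\mathcal A\}$. A $1/d$-covering $\mathcal A_d^{-1}$ on $D_{\mathcal A}$ is a finite subset of $\mathcal A^{-1}$ such that for every $A^{-1}\in\mathcal A^{-1}$ there is $B\in\mathcal A_d^{-1}$ with $\|A^{-1}-B\|_{L^\infty(D_{\mathcal A})}\le1/d$, where $\|(g_1,g_2)\|_{L^\infty(D_{\mathcal A})}=\max_{i=1,2}\sup_{z\in D_{\mathcal A}}|g_i(z)|$. Classifier: An image $\mathbf X$ is viewed as a function on $\mathbb R^2$ by $\mathbf X(u,v)=\sum_{j,\ell\in\mathbb Z}X_{j,\ell}\mathbf 1((u,v)\in I_{j,\ell})$ with $X_{j,\ell}:=0$ unless $j,\ell\in\{1,\dots,d\}$. For $B:\mathbb R^2\to\mathbb R^2$ put $\mathbf X\circ B(u,v)=\mathbf X(B(u,v))$ and $T_{\mathbf X\circ B}=\mathbf X\circ B/\|\mathbf X\circ B\|_{L^2(\mathbb R^2)}$. The inverse mapping classifier is $\widehat k:=k_{\widehat i}$ with $\widehat i\in\arg\min_{i\in\{1,\dots,n\}}\min_{B_i,B\in\mathcal A_d^{-1}}\|T_{\mathbf X_i\circ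 B_i}-T_{\mathbf X\circ B}\|_{L^2(\mathbb R^2)}$ (any minimizer). Separation quantity: $D:=D(f_0,f_1)\vee D(f_1,f_0)$ with $$D(f,g):=\frac{\inf_{a\in\mathbb R,\ A_1,A_2,A_3,A_4\in\mathcal A}\|a\,f\circ A_1\circ A_2^{-1}-g\circ A_3\circ A_4^{-1}\|_{L^2(\mathbb R^2)}}{\|g\|_{L^2(\mathbb R^2)}}.$$ *)

theory Defs
  imports "HOL-Analysis.Analysis"
begin

text \<open>The plane is \<open>real^2\<close>, with the point \<open>(u, v)\<close> being \<open>x\<close> such that \<open>x $ 1 = u\<close> and
  \<open>x $ 2 = v\<close>. The square \<open>[0,1]\<^sup>2\<close> is \<open>cbox 0 1\<close>. Labels are the natural numbers 0 and 1, and
  a family \<open>f :: nat \<Rightarrow> _\<close> holds the two templates as \<open>f 0\<close> and \<open>f 1\<close>.\<close>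

type_synonym deformation = "real^2 \<Rightarrow> real^2"

text \<open>Only the entries \<open>X j l\<close> with \<open>1 \<le> j, l \<le> d\<close> of a \<open>d \<times> d\<close> image are meaningful.\<close>

type_synonym image = "int \<Rightarrow> int \<Rightarrow> real"

definition rect :: "real \<Rightarrow> real \<Rightarrow> real \<Rightarrow> real \<Rightarrow> (real^2) set" where
  "rect l r b t = {x. l \<le> x $ 1 \<and> x $ 1 \<le> r \<and> b \<le> x $ 2 \<and> x $ 2 \<le> t}"

definition pixel :: "nat \<Rightarrow> int \<Rightarrow> int \<Rightarrow> (real^2) set" where
  "pixel d j l = {x. (of_int j - 1) / real d \<le> x $ 1 \<and> x $ 1 < of_int j / real d \<and>
                     (of_int l - 1) / real d \<le> x $ 2 \<and> x $ 2 < of_int l / real d}"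

definition L1_norm_unit :: "(real^2 \<Rightarrow> real) \<Rightarrow> real" where
  "L1_norm_unit g = (LINT x:cbox 0 1|lborel. \<bar>g x\<bar>)"

text \<open>Below, this is only used for bounded measurable functions with bounded support, so that the
  value 0 of the integral for non-integrable integrands plays no role.\<close>

definition L2_norm :: "(real^2 \<Rightarrow> real) \<Rightarrow> real" where
  "L2_norm g = sqrt (LINT x|lborel. (g x)\<^sup>2)"

text \<open>Real-valued suprema: below, this is only used for continuous maps on a nonempty compact
  set.\<close>

definition Linf_norm_on :: "(real^2) set \<Rightarrow> (real^2 \<Rightarrow> real^2) \<Rightarrow> real" where
  "Linf_norm_on S g = max (SUP z\<in>S. \<bar>g z $ 1\<bar>) (SUP z\<in>S. \<bar>g z $ 2\<bar>)"

definition has_partial :: "2 \<Rightarrow> (real^2 \<Rightarrow> real) \<Rightarrow> real^2 \<Rightarrow> bool" where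
  "has_partial j g x \<longleftrightarrow> (\<lambda>t. g (x + t *\<^sub>R axis j 1)) field_differentiable (at 0)"

definition partial_deriv :: "2 \<Rightarrow> (real^2 \<Rightarrow> real) \<Rightarrow> real^2 \<Rightarrow> real" where
  "partial_deriv j g x = deriv (\<lambda>t. g (x + t *\<^sub>R axis j 1)) 0"

definition jacobian :: "deformation \<Rightarrow> real^2 \<Rightarrow> real^2^2" where
  "jacobian A x = (\<chi> i j. partial_deriv j (\<lambda>y. A y $ i) x)"

definition template :: "(real^2 \<Rightarrow> real) \<Rightarrow> bool" where
  "template g \<longleftrightarrow> (\<forall>x. 0 \<le> g x) \<and> (\<exists>x. g x \<noteq> 0)"

definition generated_image ::
  "nat \<Rightarrow> (nat \<Rightarrow> real^2 \<Rightarrow> real) \<Rightarrow> deformation set \<Rightarrow> image \<Rightarrow> nat \<Rightarrow> bool" where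
  "generated_image d f \<A> X k \<longleftrightarrow> k \<in> {0, 1} \<and>
     (\<exists>A\<in>\<A>. \<exists>\<eta>>0. \<forall>j\<in>{1..int d}. \<forall>l\<in>{1..int d}.
        X j l = (real d)\<^sup>2 * \<eta> * (LINT x:pixel d j l|lborel. f k (A x)))"

definition template_assumption ::
  "real \<Rightarrow> real \<Rightarrow> real \<Rightarrow> real \<Rightarrow> real \<Rightarrow> (nat \<Rightarrow> real^2 \<Rightarrow> real) \<Rightarrow> bool" where
  "template_assumption C\<^sub>L \<beta>\<^sub>l \<beta>\<^sub>r \<beta>\<^sub>d \<beta>\<^sub>u f \<longleftrightarrow>
     rect \<beta>\<^sub>l \<beta>\<^sub>r \<beta>\<^sub>d \<beta>\<^sub>u \<subseteq> cbox 0 1 \<and> C\<^sub>L > 0 \<and>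
     (\<forall>k\<in>{0, 1}. {x. f k x \<noteq> 0} \<subseteq> rect \<beta>\<^sub>l \<beta>\<^sub>r \<beta>\<^sub>d \<beta>\<^sub>u \<and>
        (\<forall>x y. \<bar>f k x - f k y\<bar> \<le> C\<^sub>L * L1_norm_unit (f k) * (\<bar>x $ 1 - y $ 1\<bar> + \<bar>x $ 2 - y $ 2\<bar>)))"

definition deformation_assumption ::
  "real \<Rightarrow> real \<Rightarrow> real \<Rightarrow> real \<Rightarrow> real \<Rightarrow> real \<Rightarrow> deformation set \<Rightarrow> bool" where
  "deformation_assumption C\<^sub>A C\<^sub>J \<beta>\<^sub>l \<beta>\<^sub>r \<beta>\<^sub>d \<beta>\<^sub>u \<A> \<longleftrightarrow>
     id \<in> \<A> \<and>
     (\<forall>A\<in>\<A>. rect \<beta>\<^sub>l \<beta>\<^sub>r \<beta>\<^sub>d \<beta>\<^sub>u \<subseteq> A ` cbox 0 1 \<and>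
        (\<forall>i j. (\<forall>x. has_partial j (\<lambda>y. A y $ i) x) \<and>
               continuous_on UNIV (partial_deriv j (\<lambda>y. A y $ i)) \<and>
               (\<forall>x. \<bar>partial_deriv j (\<lambda>y. A y $ i) x\<bar> \<le> C\<^sub>A))) \<and>
     C\<^sub>J > 0 \<and> C\<^sub>J\<^sup>2 = (INF A\<in>\<A>. INF x. \<bar>det (jacobian A x)\<bar>)"

definition covering_domain :: "real \<Rightarrow> (real^2) set" where
  "covering_domain C\<^sub>A = rect (- 2 * C\<^sub>A - 1) (2 * C\<^sub>A + 1) (- 2 * C\<^sub>A - 1) (2 * C\<^sub>A + 1)"

definition is_covering ::
  "nat \<Rightarrow> (real^2) set \<Rightarrow> deformation set \<Rightarrow> deformation set \<Rightarrow> bool" where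
  "is_covering d S \<A> \<B> \<longleftrightarrow> finite \<B> \<and> \<B> \<subseteq> inv ` \<A> \<and>
     (\<forall>A'\<in>inv ` \<A>. \<exists>B\<in>\<B>. Linf_norm_on S (\<lambda>z. A' z - B z) \<le> 1 / real d)"

text \<open>Restricting the sum to \<open>1 \<le> j, l \<le> d\<close> is the convention \<open>X j l = 0\<close> for all other
  indices.\<close>

definition image_fun :: "nat \<Rightarrow> image \<Rightarrow> real^2 \<Rightarrow> real" where
  "image_fun d X x = (\<Sum>j\<in>{1..int d}. \<Sum>l\<in>{1..int d}. X j l * indicator (pixel d j l) x)"

definition normalized :: "nat \<Rightarrow> image \<Rightarrow> deformation \<Rightarrow> real^2 \<Rightarrow> real" where
  "normalized d X B x = image_fun d X (B x) / L2_norm (image_fun d X \<circ> B)"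

definition image_discrepancy :: "nat \<Rightarrow> deformation set \<Rightarrow> image \<Rightarrow> image \<Rightarrow> real" where
  "image_discrepancy d \<B> X Y =
     Min {L2_norm (\<lambda>x. normalized d X B' x - normalized d Y B x) | B' B. B' \<in> \<B> \<and> B \<in> \<B>}"

text \<open>The classifier is a relation because the minimizing index need not be unique: \<open>khat\<close> is an
  output of the classifier if it is the label of some minimizer.\<close>

definition inverse_mapping_classifier ::
  "nat \<Rightarrow> deformation set \<Rightarrow> nat \<Rightarrow> (nat \<Rightarrow> image) \<Rightarrow> (nat \<Rightarrow> nat) \<Rightarrow> image \<Rightarrow> nat \<Rightarrow> bool" where
  "inverse_mapping_classifier d \<B> n Xs ks X khat \<longleftrightarrow>
     (\<exists>i. is_arg_min (\<lambda>i. image_discrepancy d \<B> (Xs i) X) (\<lambda>i. i \<in> {1..n}) i \<and> khat = ks i)"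

definition separation_dir ::
  "deformation set \<Rightarrow> (real^2 \<Rightarrow> real) \<Rightarrow> (real^2 \<Rightarrow> real) \<Rightarrow> real" where
  "separation_dir \<A> f g =
     Inf {L2_norm (\<lambda>x. a * (f \<circ> A1 \<circ> inv A2) x - (g \<circ> A3 \<circ> inv A4) x) | a A1 A2 A3 A4.
            A1 \<in> \<A> \<and> A2 \<in> \<A> \<and> A3 \<in> \<A> \<and> A4 \<in> \<A>} / L2_norm g"

definition separation ::
  "deformation set \<Rightarrow> (real^2 \<Rightarrow> real) \<Rightarrow> (real^2 \<Rightarrow> real) \<Rightarrow> real" where
  "separation \<A> f g = max (separation_dir \<A> f g) (separation_dir \<A> g f)"

end

theory Submission
  imports Defs
begin

text \<open>The deformations and their inverses are uniformly Lipschitz (the inverses by the inverse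
  function theorem and the lower bound on the Jacobian determinant), so an image \<open>X\<close> with template
  \<open>h\<close> and deformation \<open>A\<close> is uniformly within \<open>O(\<eta> \<parallel>h\<parallel>\<^sub>1 / d)\<close> of \<open>\<eta> h \<circ> A\<close>. Moreover \<open>\<parallel>h \<circ> A \<circ> B\<parallel>\<^sub>2\<close> is
  bounded below by a multiple of \<open>\<parallel>h\<parallel>\<^sub>1\<close>, because the Lipschitz function \<open>h\<close> stays large near its
  maximum; hence normalization preserves the rate \<open>1/d\<close>. Choosing \<open>B\<close> in the covering close to
  \<open>A\<^sup>-\<^sup>1\<close> brings images of the same label to distance \<open>O(1/d)\<close> of each other, so the minimal
  discrepancy is \<open>O(1/d)\<close>. If the minimizer had the other label, rescaling the two normalized images
  would exhibit \<open>D\<close> as \<open>O(1/d)\<close>, in both directions.\<close>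

section \<open>Lipschitz bounds for deformations and their inverses\<close>

lemma partial_DERIV:
  assumes "\<And>x. has_partial j g x"
  shows "((\<lambda>t. g (x + t *\<^sub>R axis j 1)) has_real_derivative
           partial_deriv j g (x + t *\<^sub>R axis j 1)) (at t)"
proof -
  have "((\<lambda>s. g ((x + t *\<^sub>R axis j 1) + s *\<^sub>R axis j 1)) has_real_derivative
           partial_deriv j g (x + t *\<^sub>R axis j 1)) (at 0)"
    using assms unfolding has_partial_def partial_deriv_def
    by (simp add: DERIV_deriv_iff_field_differentiable)
  then have "((\<lambda>s. g (x + (s + t) *\<^sub>R axis j 1)) has_real_derivative
           partial_deriv j g (x + t *\<^sub>R axis j 1)) (at 0)"
    by (simp add: algebra_simps)
  then show ?thesis
    using DERIV_shift[of "\<lambda>t. g (x + t *\<^sub>R axis j 1)" _ 0 t] by simp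
qed

lemma partial_lipschitz_axis:
  assumes "\<And>x. has_partial j g x" "\<And>x. \<bar>partial_deriv j g x\<bar> \<le> C"
  shows "\<bar>g (x + t *\<^sub>R axis j 1) - g x\<bar> \<le> C * \<bar>t\<bar>"
proof -
  have "norm (g (x + t *\<^sub>R axis j 1) - g (x + 0 *\<^sub>R axis j 1)) \<le> C * norm (t - 0)"
    by (rule field_differentiable_bound[of UNIV _ "\<lambda>t. partial_deriv j g (x + t *\<^sub>R axis j 1)"])
      (use partial_DERIV[OF assms(1)] assms(2) in \<open>auto intro: has_field_derivative_at_within\<close>)
  then show ?thesis by simp
qed

text \<open>The Lipschitz condition on the templates is stated in this norm. The calculus results
  use the Euclidean norm, and each passage back to \<open>l1\<close> costs a factor 2.\<close>

definition l1 :: "real^2 \<Rightarrow> real" where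
  "l1 x = \<bar>x $ 1\<bar> + \<bar>x $ 2\<bar>"

lemma vec2_axis: "(x::real^2) = x $ 1 *\<^sub>R axis 1 1 + x $ 2 *\<^sub>R axis 2 1"
  by (simp add: vec_eq_iff forall_2 axis_def)

lemma norm_le_l1: "norm x \<le> l1 x"
  using norm_le_l1_cart[of x] by (simp add: l1_def sum_2)

lemma l1_le_norm: "l1 x \<le> 2 * norm x"
  using component_le_norm_cart[of x 1] component_le_norm_cart[of x 2] by (simp add: l1_def)

lemma l1_nonneg [simp]: "0 \<le> l1 x"
  by (simp add: l1_def)

text \<open>Move from \<open>y\<close> to \<open>x\<close> first along one axis, then along the
  other, and use the mean value bound on each leg.\<close>

lemma partial_lipschitz:
  fixes g :: "real^2 \<Rightarrow> real"
  assumes "\<And>j x. has_partial j g x" "\<And>j x. \<bar>partial_deriv j g x\<bar> \<le> C"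
  shows "\<bar>g x - g y\<bar> \<le> C * l1 (x - y)"
proof -
  define h where "h = x - y"
  have x: "x = (y + h $ 1 *\<^sub>R axis 1 1) + h $ 2 *\<^sub>R axis 2 1"
    using vec2_axis[of h] by (simp add: h_def algebra_simps)
  have "\<bar>g x - g (y + h $ 1 *\<^sub>R axis 1 1)\<bar> \<le> C * \<bar>h $ 2\<bar>"
    by (subst x, rule partial_lipschitz_axis) (use assms in auto)
  moreover have "\<bar>g (y + h $ 1 *\<^sub>R axis 1 1) - g y\<bar> \<le> C * \<bar>h $ 1\<bar>"
    by (rule partial_lipschitz_axis) (use assms in auto)
  ultimately show ?thesis by (simp add: l1_def flip: h_def) (simp add: algebra_simps)
qed

text \<open>Reading \<open>g\<close> in product coordinates through \<open>P\<close> lets continuous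
  partial derivatives combine into a total derivative, which is then pulled back along the
  coordinate map.\<close>

lemma continuous_partials_has_derivative:
  fixes g :: "real^2 \<Rightarrow> real"
  assumes hp: "\<And>j x. has_partial j g x" and cont: "\<And>j. continuous_on UNIV (partial_deriv j g)"
  shows "(g has_derivative (\<lambda>h. partial_deriv 1 g z * h $ 1 + partial_deriv 2 g z * h $ 2)) (at z)"
proof -
  define P :: "real \<Rightarrow> real \<Rightarrow> real^2" where "P u v = u *\<^sub>R axis 1 1 + v *\<^sub>R axis 2 1" for u v
  have apply_scaled: "blinfun_apply (c *\<^sub>R id_blinfun) = (*) c" for c :: real
    by (simp add: fun_eq_iff blinfun.scaleR_left)
  have P_cont: "continuous_on UNIV (\<lambda>p. P (fst p) (snd p))"
    unfolding P_def by (intro continuous_intros)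
  have 1: "((\<lambda>u. g (P u v)) has_derivative (\<lambda>t. t * partial_deriv 1 g (P u v))) (at u)" for u v
    using partial_DERIV[of 1 g "v *\<^sub>R axis 2 1" u, OF hp]
    by (simp add: P_def has_field_derivative_def mult_commute_abs add.commute)
  have 2: "((\<lambda>v. g (P u v)) has_derivative
      blinfun_apply (partial_deriv 2 g (P u v) *\<^sub>R id_blinfun)) (at v)" for u v
    using partial_DERIV[of 2 g "u *\<^sub>R axis 1 1" v, OF hp]
    by (simp add: P_def has_field_derivative_def apply_scaled)
  have "continuous_on UNIV (\<lambda>p. partial_deriv 2 g (P (fst p) (snd p)))"
    using continuous_on_compose2[OF cont P_cont] by simp
  then have 3: "continuous (at (u, v) within UNIV \<times> UNIV)
      (\<lambda>(u, v). partial_deriv 2 g (P u v) *\<^sub>R (id_blinfun :: real \<Rightarrow>\<^sub>L real))" for u v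
    by (auto simp: case_prod_unfold continuous_on_eq_continuous_at intro!: continuous_intros)
  have D: "((\<lambda>(u, v). g (P u v)) has_derivative (\<lambda>(tu, tv). tu * partial_deriv 1 g (P u v) +
      blinfun_apply (partial_deriv 2 g (P u v) *\<^sub>R id_blinfun) tv)) (at (u, v) within UNIV \<times> UNIV)" for u v
    by (rule has_derivative_partialsI[OF 1 _ 3]) (use 2 in auto)
  have Pz: "P (z $ 1) (z $ 2) = z" for z
    using vec2_axis[of z] by (simp add: P_def)
  have "((\<lambda>z. (z $ 1, z $ 2)) has_derivative (\<lambda>h. (h $ 1, h $ 2))) (at z)"
    by (auto intro!: bounded_linear_imp_has_derivative bounded_linear_Pair bounded_linear_vec_nth)
  from has_derivative_compose[OF this, of "\<lambda>(u, v). g (P u v)"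
      "\<lambda>(tu, tv). tu * partial_deriv 1 g z + tv * partial_deriv 2 g z"] D[of "z $ 1" "z $ 2"]
  show ?thesis
    by (simp add: Pz apply_scaled case_prod_unfold mult.commute)
qed

lemma vec_has_derivativeI:
  fixes A :: "real^2 \<Rightarrow> real^2"
  assumes "\<And>i. ((\<lambda>y. A y $ i) has_derivative (\<lambda>h. A' h $ i)) (at x)"
  shows "(A has_derivative A') (at x)"
  unfolding has_derivative_componentwise_within[of A]
  using assms by (auto simp: Basis_vec_def inner_axis)

lemma jacobian_has_derivative:
  assumes "\<And>i j x. has_partial j (\<lambda>y. A y $ i) x"
    and "\<And>i j. continuous_on UNIV (partial_deriv j (\<lambda>y. A y $ i))"
  shows "(A has_derivative (\<lambda>h. jacobian A x *v h)) (at x)"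
  using continuous_partials_has_derivative[of "\<lambda>y. A y $ _", OF assms]
  by (intro vec_has_derivativeI) (simp add: matrix_vector_mult_def jacobian_def sum_2)

text \<open>Cramer's rule: \<open>det M\<close> times \<open>v\<close> is the adjugate of
  \<open>M\<close> applied to \<open>w\<close>, and in dimension two the adjugate has the same
  entries as \<open>M\<close> up to sign and position.\<close>

lemma l1_le_matrix_vector_mult:
  fixes M :: "real^2^2"
  assumes "\<And>i j. \<bar>M $ i $ j\<bar> \<le> C" "c \<le> \<bar>det M\<bar>" "0 < c"
  shows "l1 v \<le> 2 * C / c * l1 (M *v v)"
proof -
  define w where "w = M *v v"
  have w: "w $ 1 = M$1$1 * v$1 + M$1$2 * v$2" "w $ 2 = M$2$1 * v$1 + M$2$2 * v$2"
    by (simp_all add: w_def matrix_vector_mult_def sum_2)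
  have C: "0 \<le> C" using assms(1)[of 1 1] by linarith
  have bound: "\<bar>a * w $ 1 - b * w $ 2\<bar> \<le> C * l1 w" if "\<bar>a\<bar> \<le> C" "\<bar>b\<bar> \<le> C" for a b
  proof -
    have "\<bar>a * w $ 1 - b * w $ 2\<bar> \<le> \<bar>a\<bar> * \<bar>w $ 1\<bar> + \<bar>b\<bar> * \<bar>w $ 2\<bar>"
      by (metis abs_mult abs_triangle_ineq4)
    also have "\<dots> \<le> C * \<bar>w $ 1\<bar> + C * \<bar>w $ 2\<bar>"
      by (intro add_mono mult_right_mono that) auto
    finally show ?thesis by (simp add: l1_def distrib_left)
  qed
  have "det M * v $ 1 = M$2$2 * w$1 - M$1$2 * w$2" "det M * v $ 2 = - (M$2$1 * w$1 - M$1$1 * w$2)"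
    by (simp_all add: det_2 w algebra_simps)
  then have "\<bar>det M\<bar> * \<bar>v $ 1\<bar> \<le> C * l1 w" "\<bar>det M\<bar> * \<bar>v $ 2\<bar> \<le> C * l1 w"
    using bound[of "M$2$2" "M$1$2"] bound[of "M$2$1" "M$1$1"] assms(1)
    by (simp_all add: abs_minus_commute flip: abs_mult)
  then have "\<bar>det M\<bar> * l1 v \<le> 2 * (C * l1 w)"
    by (simp add: l1_def distrib_left)
  moreover have "c * l1 v \<le> \<bar>det M\<bar> * l1 v"
    by (intro mult_right_mono assms) auto
  ultimately show ?thesis
    using assms(3) by (simp add: field_simps w_def)
qed

lemma inv_lipschitz:
  fixes A :: "real^2 \<Rightarrow> real^2"
  assumes "bij A" and hp: "\<And>i j x. has_partial j (\<lambda>y. A y $ i) x"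
    and cont: "\<And>i j. continuous_on UNIV (partial_deriv j (\<lambda>y. A y $ i))"
    and bound: "\<And>i j x. \<bar>partial_deriv j (\<lambda>y. A y $ i) x\<bar> \<le> C"
    and det: "\<And>x. c \<le> \<bar>det (jacobian A x)\<bar>" "0 < c"
  shows "l1 (inv A x - inv A y) \<le> 8 * C / c * l1 (x - y)"
proof -
  note der = jacobian_has_derivative[OF hp cont]
  have C: "0 \<le> C" using bound[of 1 1 0] by linarith
  have "continuous_on UNIV A"
    using der has_derivative_continuous continuous_at_imp_continuous_on by blast
  \<comment> \<open>Invariance of domain: a continuous injective map of the plane has a continuous
    inverse on its image. The derivative rule for inverses requires this continuity.\<close>
  then have "continuous_on (A ` UNIV) (inv A)"
    using \<open>bij A\<close> by (intro continuous_on_inverse_open) (auto simp: bij_is_inj)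
  then have inv_cont: "continuous (at y) (inv A)" for y
    using \<open>bij A\<close> by (simp add: bij_is_surj continuous_on_eq_continuous_at)
  have "invertible (jacobian A x)" for x
    using det(1)[of x] det(2) by (auto simp: invertible_det_nz)
  then have "\<forall>y. \<exists>N. jacobian A (inv A y) ** N = mat 1 \<and> N ** jacobian A (inv A y) = mat 1"
    by (simp add: invertible_def)
  from choice[OF this] obtain N where N: "jacobian A (inv A y) ** N y = mat 1" "N y ** jacobian A (inv A y) = mat 1" for y
    by auto
  have "(inv A has_derivative (\<lambda>h. N y *v h)) (at y)" for y
  proof (rule has_derivative_inverse_basic[OF der _ _ inv_cont open_UNIV])
    show "(*v) (N y) \<circ> (*v) (jacobian A (inv A y)) = id"
      by (simp add: fun_eq_iff N matrix_vector_mul_assoc)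
    show "A (inv A z) = z" for z
      using \<open>bij A\<close> by (simp add: bij_is_surj surj_f_inv_f)
  qed (auto intro: matrix_vector_mul_bounded_linear)
  \<comment> \<open>Cramer's rule gives \<open>2 * C / c\<close> in \<open>l1\<close>; bounding
    \<open>l1 h\<close> by the Euclidean norm doubles it, and returning to \<open>l1\<close> at the
    end doubles it again, whence the 8.\<close>
  moreover have "onorm (\<lambda>h. N y *v h) \<le> 4 * C / c" for y
  proof (rule onorm_le)
    fix h :: "real^2"
    have "jacobian A (inv A y) *v (N y *v h) = h"
      by (simp add: N matrix_vector_mul_assoc)
    then have "l1 (N y *v h) \<le> 2 * C / c * l1 h"
      using l1_le_matrix_vector_mult[of "jacobian A (inv A y)" C c "N y *v h"] bound det
      by (simp add: jacobian_def)
    also have "\<dots> \<le> 2 * C / c * (2 * norm h)"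
      using C \<open>0 < c\<close> by (intro mult_left_mono l1_le_norm) auto
    finally show "norm (N y *v h) \<le> 4 * C / c * norm h"
      using norm_le_l1[of "N y *v h"] by simp
  qed
  ultimately have "norm (inv A x - inv A y) \<le> 4 * C / c * norm (x - y)"
    by (intro differentiable_bound[of UNIV _ "\<lambda>y h. N y *v h"]) auto
  also have "\<dots> \<le> 4 * C / c * l1 (x - y)"
    using C \<open>0 < c\<close> by (intro mult_left_mono norm_le_l1) auto
  finally show ?thesis using l1_le_norm[of "inv A x - inv A y"] by simp
qed

section \<open>The \<open>L\<^sup>2\<close> norm\<close>

text \<open>The integral of a non-integrable function is 0 by convention, so the estimates for
  \<open>L2_norm\<close> carry this guard.\<close>

definition sq_int :: "(real^2 \<Rightarrow> real) \<Rightarrow> bool" where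
  "sq_int g \<longleftrightarrow> g \<in> borel_measurable borel \<and> integrable lborel (\<lambda>x. (g x)\<^sup>2)"

lemma L2_norm_nonneg [simp]: "0 \<le> L2_norm g"
  by (simp add: L2_norm_def)

lemma L2_norm_power2: "(L2_norm g)\<^sup>2 = (LINT x|lborel. (g x)\<^sup>2)"
  by (simp add: L2_norm_def)

lemma L2_norm_scale: "L2_norm (\<lambda>x. c * g x) = \<bar>c\<bar> * L2_norm g"
  by (simp add: L2_norm_def power_mult_distrib real_sqrt_mult)

lemma sq_int_scale: "sq_int g \<Longrightarrow> sq_int (\<lambda>x. c * g x)"
  by (auto simp: sq_int_def power_mult_distrib)

text \<open>The free weight \<open>t\<close> will be a ratio of two norms; integrating the pointwise
  inequality with that weight yields Minkowski's inequality.\<close>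

lemma square_add_le_weighted:
  fixes a b t :: real
  assumes "0 < t"
  shows "(a + b)\<^sup>2 \<le> (1 + t) * a\<^sup>2 + (1 + 1 / t) * b\<^sup>2"
proof -
  have "0 \<le> (t * a - b)\<^sup>2 / t" using assms by simp
  also have "(t * a - b)\<^sup>2 / t = (1 + t) * a\<^sup>2 + (1 + 1 / t) * b\<^sup>2 - (a + b)\<^sup>2"
    using assms by (simp add: field_simps power2_eq_square)
  finally show ?thesis by simp
qed

lemma sq_int_add:
  assumes "sq_int f" "sq_int g"
  shows "sq_int (\<lambda>x. f x + g x)"
proof -
  have "integrable lborel (\<lambda>x. (f x + g x)\<^sup>2)"
  proof (rule Bochner_Integration.integrable_bound)
    show "integrable lborel (\<lambda>x. 2 * (f x)\<^sup>2 + 2 * (g x)\<^sup>2)"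
      using assms by (auto simp: sq_int_def)
    show "(\<lambda>x. (f x + g x)\<^sup>2) \<in> borel_measurable lborel"
      using assms by (auto simp: sq_int_def)
    show "AE x in lborel. norm ((f x + g x)\<^sup>2) \<le> norm (2 * (f x)\<^sup>2 + 2 * (g x)\<^sup>2)"
      using square_add_le_weighted[of 1] by auto
  qed
  then show ?thesis using assms by (auto simp: sq_int_def)
qed

lemma sq_int_diff:
  assumes "sq_int f" "sq_int g"
  shows "sq_int (\<lambda>x. f x - g x)"
  using sq_int_add[OF assms(1) sq_int_scale[OF assms(2), of "-1"]] by simp

lemma L2_norm_add:
  assumes "sq_int f" "sq_int g"
  shows "L2_norm (\<lambda>x. f x + g x) \<le> L2_norm f + L2_norm g"
proof (rule field_le_epsilon)
  fix e :: real assume "0 < e"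
  \<comment> \<open>The slack keeps both numbers positive, so the weight \<open>b / a\<close> makes
    sense even if a norm is 0. With this weight the right-hand side collapses to a perfect
    square.\<close>
  define a b where "a = L2_norm f + e / 2" and "b = L2_norm g + e / 2"
  have pos: "0 < a" "0 < b"
    using \<open>0 < e\<close> by (auto simp: a_def b_def intro!: add_nonneg_pos)
  then have "0 < b / a" by simp
  have sq: "integrable lborel (\<lambda>x. (f x)\<^sup>2)" "integrable lborel (\<lambda>x. (g x)\<^sup>2)"
    using assms by (auto simp: sq_int_def)
  have "(LINT x|lborel. (f x + g x)\<^sup>2)
      \<le> (LINT x|lborel. (1 + b / a) * (f x)\<^sup>2 + (1 + 1 / (b / a)) * (g x)\<^sup>2)"
    using sq_int_add[OF assms] sq square_add_le_weighted[OF \<open>0 < b / a\<close>]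
    by (intro integral_mono) (auto simp: sq_int_def)
  also have "\<dots> = (1 + b / a) * (L2_norm f)\<^sup>2 + (1 + a / b) * (L2_norm g)\<^sup>2"
    using sq by (simp add: L2_norm_power2)
  also have "\<dots> \<le> (1 + b / a) * a\<^sup>2 + (1 + a / b) * b\<^sup>2"
    using pos \<open>0 < e\<close> by (intro add_mono mult_left_mono power_mono) (auto simp: a_def b_def)
  also have "\<dots> = (a + b)\<^sup>2"
    using pos by (simp add: field_simps power2_eq_square)
  finally have "(L2_norm (\<lambda>x. f x + g x))\<^sup>2 \<le> (a + b)\<^sup>2"
    by (simp add: L2_norm_power2)
  then have "L2_norm (\<lambda>x. f x + g x) \<le> a + b"
    using pos power2_le_imp_le[of "L2_norm (\<lambda>x. f x + g x)" "a + b"] by auto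
  then show "L2_norm (\<lambda>x. f x + g x) \<le> L2_norm f + L2_norm g + e"
    by (simp add: a_def b_def)
qed

lemma L2_norm_minus_commute: "L2_norm (\<lambda>x. f x - g x) = L2_norm (\<lambda>x. g x - f x)"
  by (simp add: L2_norm_def power2_commute)

lemma L2_norm_diff_triangle:
  assumes "sq_int f" "sq_int g" "sq_int h"
  shows "L2_norm (\<lambda>x. f x - h x) \<le> L2_norm (\<lambda>x. f x - g x) + L2_norm (\<lambda>x. g x - h x)"
  using L2_norm_add[OF sq_int_diff[OF assms(1,2)] sq_int_diff[OF assms(2,3)]] by simp

lemma L2_norm_le_add_diff:
  assumes "sq_int f" "sq_int g"
  shows "L2_norm f \<le> L2_norm g + L2_norm (\<lambda>x. f x - g x)"
  using L2_norm_add[OF assms(2) sq_int_diff[OF assms]] by simp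

text \<open>The difference is \<open>(1 / L2_norm u - 1 / L2_norm v) * u\<close> plus
  \<open>(u - v) / L2_norm v\<close>. By the reverse triangle inequality each summand contributes at
  most the relative error, whence the factor 2.\<close>

lemma L2_norm_normalize_diff:
  assumes "sq_int u" "sq_int v" "0 < L2_norm v"
  shows "L2_norm (\<lambda>x. u x / L2_norm u - v x / L2_norm v)
    \<le> 2 * L2_norm (\<lambda>x. u x - v x) / L2_norm v"
proof (cases "L2_norm u = 0")
  case True
  \<comment> \<open>Division by zero gives 0, so only the normalized \<open>v\<close> remains, with
    norm 1; here the relative error is at least 1 as well.\<close>
  have "L2_norm (\<lambda>x. u x / L2_norm u - v x / L2_norm v) = L2_norm (\<lambda>x. (- 1 / L2_norm v) * v x)"
    by (simp add: True)
  also have "\<dots> = 1"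
    unfolding L2_norm_scale using assms(3) by simp
  also have "\<dots> \<le> 2 * L2_norm (\<lambda>x. u x - v x) / L2_norm v"
    using L2_norm_le_add_diff[OF assms(2,1)] assms(3) L2_norm_minus_commute[of u v]
    by (simp add: True field_simps)
  finally show ?thesis .
next
  case False
  then have U: "0 < L2_norm u" using L2_norm_nonneg[of u] by linarith
  define \<Delta> where "\<Delta> = L2_norm (\<lambda>x. u x - v x)"
  have \<Delta>: "\<bar>L2_norm v - L2_norm u\<bar> \<le> \<Delta>"
    using L2_norm_le_add_diff[OF assms(2,1)] L2_norm_le_add_diff[OF assms(1,2)]
      L2_norm_minus_commute[of u v] by (simp add: \<Delta>_def)
  have "L2_norm (\<lambda>x. u x / L2_norm u - v x / L2_norm v) =
    L2_norm (\<lambda>x. (1 / L2_norm u - 1 / L2_norm v) * u x + 1 / L2_norm v * (u x - v x))"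
    by (simp add: algebra_simps diff_divide_distrib)
  also have "\<dots> \<le> L2_norm (\<lambda>x. (1 / L2_norm u - 1 / L2_norm v) * u x)
      + L2_norm (\<lambda>x. 1 / L2_norm v * (u x - v x))"
    by (intro L2_norm_add sq_int_scale sq_int_diff assms)
  also have "\<dots> = \<bar>1 / L2_norm u - 1 / L2_norm v\<bar> * L2_norm u + \<Delta> / L2_norm v"
    unfolding L2_norm_scale using assms(3) by (simp add: \<Delta>_def)
  also have "\<bar>1 / L2_norm u - 1 / L2_norm v\<bar> * L2_norm u = \<bar>L2_norm v - L2_norm u\<bar> / L2_norm v"
  proof -
    have "1 / L2_norm u - 1 / L2_norm v = (L2_norm v - L2_norm u) / (L2_norm u * L2_norm v)"
      using U assms(3) by (simp add: field_simps)
    then show ?thesis using U assms(3) by (simp add: abs_mult)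
  qed
  also have "\<dots> + \<Delta> / L2_norm v \<le> 2 * \<Delta> / L2_norm v"
    using \<Delta> assms(3) by (simp add: divide_right_mono flip: add_divide_distrib)
  finally show ?thesis by (simp add: \<Delta>_def)
qed

lemma bounded_support_sq_int:
  fixes g :: "real^2 \<Rightarrow> real"
  assumes meas: "g \<in> borel_measurable borel" and bound: "\<And>x. \<bar>g x\<bar> \<le> e"
    and supp: "\<And>x. g x \<noteq> 0 \<Longrightarrow> x \<in> cbox a b"
  shows "sq_int g" and "L2_norm g \<le> e * sqrt (measure lborel (cbox a b))"
proof -
  have e: "0 \<le> e" using bound[of 0] by linarith
  have int: "integrable lborel (\<lambda>x. e\<^sup>2 * indicator (cbox a b) x :: real)"
    by (intro integrable_mult_right integrable_real_indicator) (use emeasure_lborel_cbox_finite[of a b] in auto)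
  have le: "(g x)\<^sup>2 \<le> e\<^sup>2 * indicator (cbox a b) x" for x
    using bound[of x] e supp[of x] abs_le_square_iff[of "g x" e] by (auto split: split_indicator)
  have "integrable lborel (\<lambda>x. (g x)\<^sup>2)"
    by (rule Bochner_Integration.integrable_bound[OF int]) (use meas le in auto)
  then show "sq_int g" using meas by (simp add: sq_int_def)
  have "(L2_norm g)\<^sup>2 \<le> (LINT x|lborel. e\<^sup>2 * indicator (cbox a b) x)"
    unfolding L2_norm_power2 by (rule integral_mono) (use le int \<open>sq_int g\<close> in \<open>auto simp: sq_int_def\<close>)
  also have "\<dots> = (e * sqrt (measure lborel (cbox a b)))\<^sup>2"
    by (simp add: power_mult_distrib)
  finally show "L2_norm g \<le> e * sqrt (measure lborel (cbox a b))"
    using e power2_le_imp_le[of "L2_norm g" "e * sqrt (measure lborel (cbox a b))"] by auto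
qed

lemma L2_norm_lower_bound:
  fixes g :: "real^2 \<Rightarrow> real"
  assumes "sq_int g" "0 \<le> e" and lower: "\<And>x. x \<in> cbox a b \<Longrightarrow> e \<le> g x"
  shows "e * sqrt (measure lborel (cbox a b)) \<le> L2_norm g"
proof (rule power2_le_imp_le)
  have "(e * sqrt (measure lborel (cbox a b)))\<^sup>2 = (LINT x|lborel. e\<^sup>2 * indicator (cbox a b) x)"
    by (simp add: power_mult_distrib)
  also have "\<dots> \<le> (L2_norm g)\<^sup>2"
    unfolding L2_norm_power2
  proof (rule integral_mono)
    show "integrable lborel (\<lambda>x. e\<^sup>2 * indicator (cbox a b) x)"
      by (intro integrable_mult_right integrable_real_indicator) (use emeasure_lborel_cbox_finite[of a b] in auto)
    show "e\<^sup>2 * indicator (cbox a b) x \<le> (g x)\<^sup>2" for x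
      using lower[of x] \<open>0 \<le> e\<close> by (auto split: split_indicator intro: power_mono)
  qed (use assms(1) in \<open>simp add: sq_int_def\<close>)
  finally show "(e * sqrt (measure lborel (cbox a b)))\<^sup>2 \<le> (L2_norm g)\<^sup>2" .
qed simp

section \<open>Pixel averages\<close>

lemma l1_lipschitz_continuous:
  fixes g :: "real^2 \<Rightarrow> 'a::metric_space"
  assumes "\<And>x y. dist (g x) (g y) \<le> C * l1 (x - y)"
  shows "continuous_on UNIV g"
proof -
  have "dist (g x) (g y) \<le> (2 * \<bar>C\<bar>) * dist x y" for x y
  proof -
    have "dist (g x) (g y) \<le> \<bar>C\<bar> * l1 (x - y)"
      by (rule order_trans[OF assms mult_right_mono]) auto
    also have "\<dots> \<le> \<bar>C\<bar> * (2 * norm (x - y))"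
      by (intro mult_left_mono l1_le_norm) auto
    finally show ?thesis by (simp add: dist_norm)
  qed
  then have "(2 * \<bar>C\<bar>)-lipschitz_on UNIV g"
    by (intro lipschitz_onI) auto
  then show ?thesis by (rule lipschitz_on_continuous_on)
qed

lemma unit_square_iff: "(x::real^2) \<in> cbox 0 1 \<longleftrightarrow> 0 \<le> x $ 1 \<and> x $ 1 \<le> 1 \<and> 0 \<le> x $ 2 \<and> x $ 2 \<le> 1"
  by (auto simp: mem_box_cart forall_2)

lemma measure_cbox_vec2:
  fixes a b :: "real^2"
  assumes "a $ 1 \<le> b $ 1" "a $ 2 \<le> b $ 2"
  shows "measure lborel (cbox a b) = (b $ 1 - a $ 1) * (b $ 2 - a $ 2)"
proof -
  have "cbox a b \<noteq> {}" using assms by (auto simp: cbox_interval interval_ne_empty_cart less_eq_vec_def forall_2)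
  then show ?thesis by (simp add: content_cbox_cart UNIV_2)
qed

lemma measure_unit_square: "measure lborel (cbox 0 1 :: (real^2) set) = 1"
  by (subst measure_cbox_vec2) auto

text \<open>The unit square has area 1, so the integral over it is a mean value and cannot exceed
  the maximum.\<close>

lemma exists_ge_L1_norm_unit:
  assumes "continuous_on UNIV h" "\<And>x. 0 \<le> h x"
  obtains p where "L1_norm_unit h \<le> h p"
proof -
  have cont: "continuous_on (cbox 0 1) h" using assms(1) continuous_on_subset by blast
  have "(0::real^2) \<in> cbox 0 1" by (simp add: unit_square_iff)
  then obtain p where p: "\<And>x. x \<in> cbox 0 1 \<Longrightarrow> h x \<le> h p"
    using continuous_attains_sup[OF compact_cbox _ cont] by blast
  have "L1_norm_unit h \<le> (LINT x:(cbox 0 1 :: (real^2) set)|lborel. h p)"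
    unfolding L1_norm_unit_def
  proof (rule set_integral_mono)
    show "set_integrable lborel (cbox 0 1) (\<lambda>x. \<bar>h x\<bar>)"
      using cont unfolding set_integrable_def
      by (intro borel_integrable_compact) (auto intro: continuous_intros)
    show "set_integrable lborel (cbox 0 1) (\<lambda>x::real^2. h p)"
      unfolding set_integrable_def
      by (intro borel_integrable_compact) (auto intro: continuous_intros)
  qed (use assms p in auto)
  also have "\<dots> = h p"
    by (simp add: set_lebesgue_integral_def measure_unit_square)
  finally show ?thesis by (rule that)
qed

lemma set_integral_average_close:
  fixes g :: "real^2 \<Rightarrow> real"
  assumes S: "S \<in> sets borel" "emeasure lborel S < \<infinity>" and g: "g \<in> borel_measurable borel"
    and close: "\<And>y. y \<in> S \<Longrightarrow> \<bar>g y - c\<bar> \<le> e"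
  shows "\<bar>(LINT y:S|lborel. g y) - measure lborel S * c\<bar> \<le> measure lborel S * e"
proof -
  have const: "set_integrable lborel S (\<lambda>y. r)" for r :: real
    using S by (auto simp: set_integrable_def)
  have int: "set_integrable lborel S g"
  proof (rule set_integrable_bound[OF const[of "\<bar>c\<bar> + e"]])
    show "set_borel_measurable lborel S g"
      using S(1) g by (simp add: set_borel_measurable_def)
    show "AE y in lborel. y \<in> S \<longrightarrow> norm (g y) \<le> norm (\<bar>c\<bar> + e)"
      using close by (fastforce intro!: AE_I2)
  qed
  have "(LINT y:S|lborel. g y) \<le> (LINT y:S|lborel. c + e)" 
    by (rule set_integral_mono[OF int const]) (use close in fastforce)
  moreover have "(LINT y:S|lborel. c - e) \<le> (LINT y:S|lborel. g y)" 
    by (rule set_integral_mono[OF const int]) (use close in fastforce)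
  moreover have "(LINT y:S|lborel. r) = measure lborel S * r" for r
    using S by (simp add: set_lebesgue_integral_def)
  ultimately show ?thesis by (simp add: algebra_simps abs_le_iff)
qed

lemma pixel_borel [measurable]: "pixel d j l \<in> sets borel"
  unfolding pixel_def by measurable

lemma measure_pixel:
  assumes "1 \<le> d"
  shows "measure lborel (pixel d j l) = 1 / (real d)\<^sup>2" "emeasure lborel (pixel d j l) < \<infinity>"
proof -
  define a b :: "real^2" where "a = vector [(of_int j - 1) / real d, (of_int l - 1) / real d]"
    and "b = vector [of_int j / real d, of_int l / real d]"
  \<comment> \<open>The half-open pixel is squeezed between the open and the closed box, which have
    equal measure.\<close>
  have sub: "box a b \<subseteq> pixel d j l" "pixel d j l \<subseteq> cbox a b"
    by (auto simp: pixel_def a_def b_def mem_box_cart forall_2)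
  show fin: "emeasure lborel (pixel d j l) < \<infinity>"
    using emeasure_mono[OF sub(2), of lborel] emeasure_lborel_cbox_finite[of a b]
    by (auto intro: le_less_trans)
  have "measure lborel (box a b) \<le> measure lborel (pixel d j l)"
    using sub fin by (intro measure_mono_fmeasurable) (auto simp: fmeasurable_def)
  moreover have "measure lborel (pixel d j l) \<le> measure lborel (cbox a b)"
    using sub emeasure_lborel_cbox_finite[of a b]
    by (intro measure_mono_fmeasurable) (auto simp: fmeasurable_def)
  moreover have "measure lborel (box a b) = measure lborel (cbox a b)"
    by (simp add: measure_lborel_box_eq measure_lborel_cbox_eq)
  moreover have "measure lborel (cbox a b) = 1 / (real d)\<^sup>2"
    using assms by (subst measure_cbox_vec2)
      (auto simp: a_def b_def divide_right_mono power2_eq_square simp flip: diff_divide_distrib)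
  ultimately show "measure lborel (pixel d j l) = 1 / (real d)\<^sup>2" by simp
qed

text \<open>Half-open cells partition the line, so the cell of \<open>t\<close> is found by a floor;
  the shift by 1 is there because the cell starting at 0 has index 1.\<close>

lemma coordinate_cell_iff:
  assumes "1 \<le> d"
  shows "(of_int j - 1) / real d \<le> t \<and> t < of_int j / real d \<longleftrightarrow> j = \<lfloor>real d * t\<rfloor> + 1"
proof -
  have "(of_int j - 1) / real d \<le> t \<and> t < of_int j / real d \<longleftrightarrow>
      of_int (j - 1) \<le> real d * t \<and> real d * t < of_int (j - 1) + 1"
    using assms by (simp add: field_simps)
  also have "\<dots> \<longleftrightarrow> \<lfloor>real d * t\<rfloor> = j - 1"
    by (simp add: floor_eq_iff)
  finally show ?thesis by auto
qed

lemma mem_pixel_iff: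
  assumes "1 \<le> d"
  shows "x \<in> pixel d j l \<longleftrightarrow> j = \<lfloor>real d * x $ 1\<rfloor> + 1 \<and> l = \<lfloor>real d * x $ 2\<rfloor> + 1"
  using coordinate_cell_iff[OF assms] by (auto simp: pixel_def)

lemma l1_pixel:
  assumes "x \<in> pixel d j l" "y \<in> pixel d j l"
  shows "l1 (x - y) \<le> 2 / real d"
  using assms by (auto simp: pixel_def l1_def diff_divide_distrib)

text \<open>The pixels are disjoint, so at most one term of the double sum survives.\<close>

lemma image_fun_eq:
  assumes d: "1 \<le> d"
  defines "j x \<equiv> \<lfloor>real d * x $ 1\<rfloor> + 1" and "l x \<equiv> \<lfloor>real d * x $ 2\<rfloor> + 1"
  shows "image_fun d X x = (if j x \<in> {1..int d} \<and> l x \<in> {1..int d} then X (j x) (l x) else 0)"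
proof -
  have "image_fun d X x =
      (\<Sum>j'\<in>{1..int d}. \<Sum>l'\<in>{1..int d}. if l' = l x then if j' = j x then X j' l' else 0 else 0)"
    unfolding image_fun_def
    by (intro sum.cong) (auto simp: mem_pixel_iff[OF d] j_def l_def split: split_indicator)
  also have "\<dots> = (if j x \<in> {1..int d} \<and> l x \<in> {1..int d} then X (j x) (l x) else 0)"
    by (auto simp: sum.delta intro!: sum.neutral)
  finally show ?thesis .
qed

lemma coordinate_cell_index_iff:
  assumes "1 \<le> d"
  shows "\<lfloor>real d * t\<rfloor> + 1 \<in> {1..int d} \<longleftrightarrow> 0 \<le> t \<and> t < 1"
proof -
  have "\<lfloor>real d * t\<rfloor> + 1 \<in> {1..int d} \<longleftrightarrow> 0 \<le> real d * t \<and> real d * t < real d"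
    by (simp add: add1_zle_eq floor_less_iff)
  also have "\<dots> \<longleftrightarrow> 0 \<le> t \<and> t < 1" using assms by (simp add: zero_le_mult_iff)
  finally show ?thesis .
qed

lemma image_fun_borel [measurable]: "image_fun d X \<in> borel_measurable borel"
  unfolding image_fun_def by measurable

lemma image_fun_support:
  assumes "1 \<le> d" "image_fun d X x \<noteq> 0"
  shows "x \<in> cbox 0 1"
  using assms(2) unfolding image_fun_eq[OF assms(1)] coordinate_cell_index_iff[OF assms(1)]
  by (auto simp: unit_square_iff split: if_splits)

definition pixel_sampling :: "nat \<Rightarrow> real \<Rightarrow> (real^2 \<Rightarrow> real) \<Rightarrow> image \<Rightarrow> bool" where
  "pixel_sampling d \<eta> g X \<longleftrightarrow> (\<forall>j\<in>{1..int d}. \<forall>l\<in>{1..int d}.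
     X j l = (real d)\<^sup>2 * \<eta> * (LINT x:pixel d j l|lborel. g x))"

text \<open>A pixel has area \<open>1 / d^2\<close>, so each entry is \<open>\<eta>\<close> times
  the mean of \<open>g\<close> over its pixel, and two points of a pixel differ by at most
  \<open>2 / d\<close> in \<open>l1\<close>. Off the half-open unit square both functions
  vanish.\<close>

lemma pixel_average_close:
  fixes g :: "real^2 \<Rightarrow> real"
  assumes d: "1 \<le> d" and lip: "\<And>x y. \<bar>g x - g y\<bar> \<le> c * l1 (x - y)"
    and supp: "\<And>x. g x \<noteq> 0 \<Longrightarrow> x \<in> cbox 0 1" and "0 < \<eta>" and "0 \<le> c"
    and X: "pixel_sampling d \<eta> g X"
  shows "\<bar>image_fun d X x - \<eta> * g x\<bar> \<le> \<eta> * c * (2 / real d)"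
proof (cases "0 \<le> x $ 1 \<and> x $ 1 < 1 \<and> 0 \<le> x $ 2 \<and> x $ 2 < 1")
  case True
  define j l where "j = \<lfloor>real d * x $ 1\<rfloor> + 1" and "l = \<lfloor>real d * x $ 2\<rfloor> + 1"
  have jl: "j \<in> {1..int d}" "l \<in> {1..int d}"
    using True coordinate_cell_index_iff[OF d] unfolding j_def l_def by blast+
  have x: "x \<in> pixel d j l" by (simp add: mem_pixel_iff[OF d] j_def l_def)
  have [measurable]: "g \<in> borel_measurable borel"
    using l1_lipschitz_continuous[of g c] lip
    by (intro borel_measurable_continuous_onI) (auto simp: dist_real_def)
  define I where "I = (LINT x:pixel d j l|lborel. g x)"
  have "\<bar>I - measure lborel (pixel d j l) * g x\<bar> \<le> measure lborel (pixel d j l) * (c * (2 / real d))"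
    unfolding I_def
  proof (rule set_integral_average_close)
    show "\<bar>g y - g x\<bar> \<le> c * (2 / real d)" if "y \<in> pixel d j l" for y
      by (rule order_trans[OF lip mult_left_mono[OF l1_pixel[OF that x] \<open>0 \<le> c\<close>]])
  qed (use measure_pixel[OF d] in auto)
  then have "(real d)\<^sup>2 * \<eta> * \<bar>I - g x / (real d)\<^sup>2\<bar> \<le> (real d)\<^sup>2 * \<eta> * (c * (2 / real d) / (real d)\<^sup>2)"
    using \<open>0 < \<eta>\<close> by (intro mult_left_mono) (auto simp: measure_pixel[OF d] mult.commute)
  also have "\<dots> = \<eta> * c * (2 / real d)" using d by simp
  also have "(real d)\<^sup>2 * \<eta> * \<bar>I - g x / (real d)\<^sup>2\<bar> = \<bar>(real d)\<^sup>2 * \<eta> * (I - g x / (real d)\<^sup>2)\<bar>"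
    using \<open>0 < \<eta>\<close> by (simp add: abs_mult)
  also have "(real d)\<^sup>2 * \<eta> * (I - g x / (real d)\<^sup>2) = image_fun d X x - \<eta> * g x"
    using jl d X[unfolded pixel_sampling_def] unfolding image_fun_eq[OF d] j_def[symmetric] l_def[symmetric]
    by (simp add: I_def right_diff_distrib)
  finally show ?thesis .
next
  case False
  \<comment> \<open>The delicate points are the edges where a coordinate equals 1: they lie in the
    closed square but in no pixel of the image. There \<open>g\<close> vanishes by continuity, since
    it is 0 just outside the square.\<close>
  have "g x = 0"
  proof (rule ccontr)
    assume "g x \<noteq> 0"
    then have "x \<in> cbox 0 1" by (rule supp)
    with False obtain i where i: "x $ i = 1" by (auto simp: unit_square_iff)
    have "\<bar>g x\<bar> \<le> 0 + e" if "0 < e" for e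
    proof -
      \<comment> \<open>A step outwards with \<open>c * t \<le> e\<close>; adding 1 to the
        denominator covers \<open>c = 0\<close>.\<close>
      define t where "t = e / (c + 1)"
      have t: "0 < t" using that \<open>0 \<le> c\<close> by (simp add: t_def)
      have "x + t *\<^sub>R axis i 1 \<notin> cbox 0 1"
        using i t by (auto simp: mem_box_cart intro!: exI[of _ i])
      then have "g (x + t *\<^sub>R axis i 1) = 0" using supp by blast
      then have "\<bar>g x\<bar> = \<bar>g (x + t *\<^sub>R axis i 1) - g x\<bar>" by simp
      also have "\<dots> \<le> c * l1 (t *\<^sub>R axis i 1)" using lip[of "x + t *\<^sub>R axis i 1" x] by simp
      also have "\<dots> = c * t" using t exhaust_2[of i] by (auto simp: l1_def axis_def)
      also have "\<dots> \<le> e" using \<open>0 \<le> c\<close> that by (simp add: t_def field_simps)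
      finally show ?thesis by simp
    qed
    then have "\<bar>g x\<bar> \<le> 0" by (rule field_le_epsilon)
    with \<open>g x \<noteq> 0\<close> show False by simp
  qed
  moreover have "image_fun d X x = 0"
    using False unfolding image_fun_eq[OF d] coordinate_cell_index_iff[OF d] by auto
  ultimately show ?thesis using \<open>0 < \<eta>\<close> \<open>0 \<le> c\<close> by simp
qed

section \<open>Separation of the labels\<close>

lemma covering_domain_eq_cbox:
  "covering_domain c = cbox (vector [- 2 * c - 1, - 2 * c - 1]) (vector [2 * c + 1, 2 * c + 1])"
  by (auto simp: covering_domain_def rect_def mem_box_cart forall_2)

lemma mem_covering_domain_iff: "x \<in> covering_domain c \<longleftrightarrow> (\<forall>i. \<bar>x $ i\<bar> \<le> 2 * c + 1)"
  by (auto simp: covering_domain_def rect_def forall_2)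

lemma bounded_support_covering_domain:
  fixes g :: "real^2 \<Rightarrow> real"
  assumes "g \<in> borel_measurable borel" "\<And>x. \<bar>g x\<bar> \<le> e"
    and "\<And>x. g x \<noteq> 0 \<Longrightarrow> x \<in> covering_domain c" and "0 < c"
  shows "sq_int g" "L2_norm g \<le> e * (4 * c + 2)"
proof -
  have "sqrt (measure lborel (covering_domain c)) = 4 * c + 2"
    using \<open>0 < c\<close> by (simp add: covering_domain_eq_cbox measure_cbox_vec2)
  then show "sq_int g" "L2_norm g \<le> e * (4 * c + 2)"
    using bounded_support_sq_int[OF assms(1,2) assms(3)[unfolded covering_domain_eq_cbox]]
    by (simp_all add: covering_domain_eq_cbox)
qed

text \<open>What the argument uses of Assumption 2: the deformations and their inverses are uniformly
  Lipschitz. The set \<open>R\<close> is the rectangle of the \<open>\<beta>\<close>'s.\<close>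

locale lipschitz_deformations =
  fixes \<A> :: "deformation set" and R :: "(real^2) set" and C\<^sub>L C\<^sub>A K :: real
  assumes id_mem: "id \<in> \<A>"
    and bij: "A \<in> \<A> \<Longrightarrow> bij A"
    and lip: "A \<in> \<A> \<Longrightarrow> \<bar>A x $ i - A y $ i\<bar> \<le> C\<^sub>A * l1 (x - y)"
    and inv_lip: "A \<in> \<A> \<Longrightarrow> l1 (inv A x - inv A y) \<le> K * l1 (x - y)"
    and range: "A \<in> \<A> \<Longrightarrow> R \<subseteq> A ` cbox 0 1"
    and R_subset: "R \<subseteq> cbox 0 1" and R_nonempty: "R \<noteq> {}"
    and CL_pos: "0 < C\<^sub>L" and CA_pos: "0 < C\<^sub>A" and K_pos: "0 < K"
begin

definition admissible :: "(real^2 \<Rightarrow> real) \<Rightarrow> bool" where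
  "admissible h \<longleftrightarrow> template h \<and> {x. h x \<noteq> 0} \<subseteq> R \<and>
     (\<forall>x y. \<bar>h x - h y\<bar> \<le> C\<^sub>L * L1_norm_unit h * l1 (x - y))"

text \<open>The side length of \<open>covering_domain C\<^sub>A\<close>, hence the root of its area:
  the factor from a uniform bound to an \<open>L2_norm\<close> bound.\<close>

definition side :: real where "side = 4 * C\<^sub>A + 2"

text \<open>This number \<open>r\<close> serves twice. On a box of half-side \<open>r\<close> a
  deformed template \<open>h\<close> varies by at most half of \<open>N = L1_norm_unit h\<close>, as
  \<open>C\<^sub>L * (2 * C\<^sub>A) * K * (2 * r) = 1 / 2\<close>; and the resulting lower bound
  for the \<open>L2_norm\<close> is \<open>(N / 2) * (2 * r) = r * N\<close>.\<close>

definition lower_const :: real where "lower_const = 1 / (8 * C\<^sub>L * C\<^sub>A * K)"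

text \<open>The uniform pixel error \<open>4 * C\<^sub>L * C\<^sub>A\<close>, turned into an
  \<open>L2_norm\<close> error by \<open>side\<close>, doubled by normalization and divided by the
  lower bound for the norm.\<close>

definition approx_const :: real where "approx_const = 8 * C\<^sub>L * C\<^sub>A * side / lower_const"

lemma side_pos: "0 < side"
  using CA_pos by (simp add: side_def)

lemma lower_const_pos: "0 < lower_const"
  using CL_pos CA_pos K_pos by (simp add: lower_const_def)

lemma l1_lip:
  assumes "A \<in> \<A>"
  shows "l1 (A x - A y) \<le> 2 * C\<^sub>A * l1 (x - y)"
  using lip[OF assms, of x 1 y] lip[OF assms, of x 2 y] by (simp add: l1_def)

lemma inv_apply [simp]: "A \<in> \<A> \<Longrightarrow> A (inv A x) = x" "A \<in> \<A> \<Longrightarrow> inv A (A x) = x"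
  using bij by (simp_all add: bij_is_surj surj_f_inv_f bij_is_inj)

lemma deformation_continuous:
  assumes "A \<in> \<A>"
  shows "continuous_on UNIV A" "continuous_on UNIV (inv A)"
proof -
  show "continuous_on UNIV A"
    by (rule l1_lipschitz_continuous[of _ "2 * C\<^sub>A"], unfold dist_norm)
      (rule order_trans[OF norm_le_l1 l1_lip[OF assms]])
  show "continuous_on UNIV (inv A)"
    by (rule l1_lipschitz_continuous[of _ K], unfold dist_norm)
      (rule order_trans[OF norm_le_l1 inv_lip[OF assms]])
qed

lemma deformation_borel:
  assumes "A \<in> \<A>"
  shows "A \<in> borel_measurable borel" "inv A \<in> borel_measurable borel"
  using deformation_continuous[OF assms] by (auto intro: borel_measurable_continuous_onI)

text \<open>Some point of the unit square is mapped into \<open>R\<close>, hence into the unit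
  square, and the unit square has \<open>l1\<close> diameter 2. This is where the size of the
  covering domain comes from.\<close>

lemma image_unit_square_subset:
  assumes A: "A \<in> \<A>" and x: "x \<in> cbox 0 1"
  shows "A x \<in> covering_domain C\<^sub>A"
proof -
  obtain y where y: "y \<in> cbox 0 1" "A y \<in> R"
    using range[OF A] R_nonempty by blast
  have Ay: "\<bar>A y $ i\<bar> \<le> 1" for i
    using y(2) R_subset by (auto simp: mem_box_cart subset_iff)
  have "l1 (x - y) \<le> 2"
    using x y(1) by (auto simp: l1_def unit_square_iff)
  then have "C\<^sub>A * l1 (x - y) \<le> C\<^sub>A * 2" using CA_pos by (intro mult_left_mono) auto
  then have "\<bar>A x $ i\<bar> \<le> 2 * C\<^sub>A + 1" for i
    using lip[OF A, of x i y] Ay[of i] by linarith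
  then show ?thesis by (simp add: mem_covering_domain_iff)
qed

lemma inv_mem_unit_square:
  assumes "A \<in> \<A>" "inv A x \<in> cbox 0 1"
  shows "x \<in> covering_domain C\<^sub>A"
  using image_unit_square_subset[OF assms] assms(1) by simp

lemma unit_square_subset: "cbox 0 1 \<subseteq> covering_domain C\<^sub>A"
  using image_unit_square_subset[OF id_mem] by auto

section \<open>Bounds for a single template and its deformations\<close>

context
  fixes h assumes adm: "admissible h"
begin

lemma admissible_nonneg: "0 \<le> h x"
  using adm by (simp add: admissible_def template_def)

lemma admissible_support: "h x \<noteq> 0 \<Longrightarrow> x \<in> R"
  using adm by (auto simp: admissible_def)

lemma admissible_lip: "\<bar>h x - h y\<bar> \<le> C\<^sub>L * L1_norm_unit h * l1 (x - y)"
  using adm by (simp add: admissible_def)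

lemma admissible_continuous: "continuous_on UNIV h"
  by (rule l1_lipschitz_continuous[of _ "C\<^sub>L * L1_norm_unit h"]) (simp add: dist_real_def admissible_lip)

lemma admissible_borel: "h \<in> borel_measurable borel"
  by (intro borel_measurable_continuous_onI admissible_continuous)

lemma admissible_upper: "h x \<le> 2 * C\<^sub>L * L1_norm_unit h"
proof (cases "h x = 0")
  case True
  have "0 \<le> L1_norm_unit h"
    unfolding L1_norm_unit_def set_lebesgue_integral_def by (intro Bochner_Integration.integral_nonneg) auto
  then show ?thesis using True CL_pos by simp
next
  case False
  have x: "x \<in> cbox 0 1" using admissible_support[OF False] R_subset by blast
  \<comment> \<open>The point with first coordinate -1 lies outside the square, so \<open>h\<close>
    vanishes there; its \<open>l1\<close> distance to \<open>x\<close> is at most 2.\<close>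
  define y where "y = x - (x $ 1 + 1) *\<^sub>R axis 1 1"
  have "y \<notin> cbox 0 1" by (simp add: y_def unit_square_iff)
  then have "h y = 0" using admissible_support R_subset by blast
  then have "h x \<le> C\<^sub>L * L1_norm_unit h * l1 (x - y)"
    using admissible_lip[of x y] by simp
  also have "l1 (x - y) = x $ 1 + 1" using x by (simp add: y_def l1_def axis_def unit_square_iff)
  finally have *: "h x \<le> C\<^sub>L * L1_norm_unit h * (x $ 1 + 1)" .
  have "0 < h x" using False admissible_nonneg[of x] by simp
  with * have "0 < C\<^sub>L * L1_norm_unit h * (x $ 1 + 1)" by linarith
  then have "0 \<le> C\<^sub>L * L1_norm_unit h"
    using x CL_pos by (auto simp: unit_square_iff zero_less_mult_iff)
  then have "C\<^sub>L * L1_norm_unit h * (x $ 1 + 1) \<le> C\<^sub>L * L1_norm_unit h * 2"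
    using x by (intro mult_left_mono) (auto simp: unit_square_iff)
  with * show ?thesis by simp
qed

lemma admissible_L1_pos: "0 < L1_norm_unit h"
proof -
  obtain x where "h x \<noteq> 0" using adm by (auto simp: admissible_def template_def)
  then have "0 < h x" using admissible_nonneg[of x] by simp
  then have "0 < 2 * C\<^sub>L * L1_norm_unit h" using admissible_upper[of x] by linarith
  then show ?thesis using CL_pos by (simp add: zero_less_mult_iff)
qed

text \<open>Every point of \<open>R\<close> has a preimage in the unit square, and by injectivity it
  has no other.\<close>

lemma admissible_comp_support:
  assumes "A \<in> \<A>" "h (A x) \<noteq> 0"
  shows "x \<in> cbox 0 1"
proof -
  obtain y where y: "y \<in> cbox 0 1" "A x = A y"
    using range[OF assms(1)] admissible_support[OF assms(2)] by blast
  then have "x = y" using bij[OF assms(1)] by (auto simp: bij_def inj_def)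
  with y show ?thesis by simp
qed

lemma admissible_comp_lip:
  assumes "A \<in> \<A>"
  shows "\<bar>h (A x) - h (A y)\<bar> \<le> C\<^sub>L * L1_norm_unit h * (2 * C\<^sub>A) * l1 (x - y)"
proof -
  have "\<bar>h (A x) - h (A y)\<bar> \<le> C\<^sub>L * L1_norm_unit h * l1 (A x - A y)" by (rule admissible_lip)
  also have "\<dots> \<le> C\<^sub>L * L1_norm_unit h * (2 * C\<^sub>A * l1 (x - y))"
    using CL_pos admissible_L1_pos by (intro mult_left_mono l1_lip assms) auto
  finally show ?thesis by (simp add: mult.assoc)
qed

lemma admissible_comp_borel:
  assumes "A1 \<in> \<A>" "A2 \<in> \<A>"
  shows "(\<lambda>x. h (A1 (inv A2 x))) \<in> borel_measurable borel"
  using measurable_compose[OF measurable_compose[OF deformation_borel(2)[OF assms(2)]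
      deformation_borel(1)[OF assms(1)]] admissible_borel] .

lemma admissible_comp_sq_int:
  assumes "A1 \<in> \<A>" "A2 \<in> \<A>"
  shows "sq_int (\<lambda>x. h (A1 (inv A2 x)))"
    and "L2_norm (\<lambda>x. h (A1 (inv A2 x))) \<le> 2 * C\<^sub>L * L1_norm_unit h * side"
proof -
  have "\<bar>h (A1 (inv A2 x))\<bar> \<le> 2 * C\<^sub>L * L1_norm_unit h" for x
    using admissible_upper admissible_nonneg by (simp add: abs_of_nonneg)
  note * = bounded_support_covering_domain[OF admissible_comp_borel[OF assms] this _ CA_pos]
  have supp: "x \<in> covering_domain C\<^sub>A" if "h (A1 (inv A2 x)) \<noteq> 0" for x
    by (rule inv_mem_unit_square[OF assms(2) admissible_comp_support[OF assms(1) that]])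
  show "sq_int (\<lambda>x. h (A1 (inv A2 x)))" by (rule *(1)) (rule supp)
  show "L2_norm (\<lambda>x. h (A1 (inv A2 x))) \<le> 2 * C\<^sub>L * L1_norm_unit h * side"
    unfolding side_def by (rule *(2)) (rule supp)
qed

text \<open>Near a maximum the template is at least half of its \<open>L\<^sup>1\<close> norm, on a ball whose radius
  depends only on the Lipschitz constants.\<close>

lemma admissible_comp_L2_lower:
  assumes "A1 \<in> \<A>" "A2 \<in> \<A>"
  shows "lower_const * L1_norm_unit h \<le> L2_norm (\<lambda>x. h (A1 (inv A2 x)))"
proof -
  define r N where "r = lower_const" and "N = L1_norm_unit h"
  have r: "0 < r" and N: "0 < N"
    using lower_const_pos admissible_L1_pos by (auto simp: r_def N_def)
  obtain p where p: "N \<le> h p"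
    unfolding N_def using exists_ge_L1_norm_unit[OF admissible_continuous admissible_nonneg] .
  \<comment> \<open>The composition sends \<open>q\<close> to the large value point
    \<open>p\<close>, so the box is centred at \<open>q\<close>.\<close>
  define q where "q = A2 (inv A1 p)"
  have q: "A1 (inv A2 q) = p" using assms by (simp add: q_def)
  define a b :: "real^2" where "a = (\<chi> i. q $ i - r)" and "b = (\<chi> i. q $ i + r)"
  have lower: "N / 2 \<le> h (A1 (inv A2 x))" if "x \<in> cbox a b" for x
  proof -
    have "\<bar>q $ i - x $ i\<bar> \<le> r" for i
      using that by (auto simp: a_def b_def mem_box_cart abs_le_iff algebra_simps)
    from this[of 1] this[of 2] have "l1 (q - x) \<le> 2 * r" by (simp add: l1_def)
    then have "K * l1 (q - x) \<le> K * (2 * r)" using K_pos by (intro mult_left_mono) auto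
    then have "l1 (inv A2 q - inv A2 x) \<le> K * (2 * r)"
      using inv_lip[OF assms(2), of q x] by linarith
    then have "C\<^sub>L * N * (2 * C\<^sub>A) * l1 (inv A2 q - inv A2 x) \<le> C\<^sub>L * N * (2 * C\<^sub>A) * (K * (2 * r))"
      using CL_pos CA_pos N by (intro mult_left_mono) auto
    also have "\<dots> = N / 2"
      using CL_pos CA_pos K_pos by (simp add: r_def lower_const_def)
    finally have "\<bar>h p - h (A1 (inv A2 x))\<bar> \<le> N / 2"
      using admissible_comp_lip[OF assms(1), of "inv A2 q" "inv A2 x"] q by (simp add: N_def)
    with p show ?thesis by linarith
  qed
  have "measure lborel (cbox a b) = (2 * r)\<^sup>2"
    using r by (simp add: measure_cbox_vec2 a_def b_def power2_eq_square)
  then have "lower_const * N = N / 2 * sqrt (measure lborel (cbox a b))"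
    using r by (simp only: real_sqrt_abs) (simp add: r_def)
  also have "\<dots> \<le> L2_norm (\<lambda>x. h (A1 (inv A2 x)))"
    using N by (intro L2_norm_lower_bound admissible_comp_sq_int(1) assms lower) auto
  finally show ?thesis by (simp add: N_def)
qed

lemma admissible_comp_L2_pos:
  assumes "A1 \<in> \<A>" "A2 \<in> \<A>"
  shows "0 < L2_norm (\<lambda>x. h (A1 (inv A2 x)))"
  using admissible_comp_L2_lower[OF assms] mult_pos_pos[OF lower_const_pos admissible_L1_pos]
  by linarith

lemma admissible_L2_lower: "lower_const * L1_norm_unit h \<le> L2_norm h"
  using admissible_comp_L2_lower[OF id_mem id_mem] by (simp add: inv_id)

lemma admissible_L2_pos: "0 < L2_norm h"
  using admissible_comp_L2_pos[OF id_mem id_mem] by (simp add: inv_id)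

lemma admissible_sq_int: "sq_int h"
  using admissible_comp_sq_int(1)[OF id_mem id_mem] by (simp add: inv_id)

end


section \<open>Normalized images approximate normalized templates\<close>

lemma image_comp_approx:
  assumes adm: "admissible h" and A: "A \<in> \<A>" and d: "1 \<le> d" and \<eta>: "0 < \<eta>"
    and X: "pixel_sampling d \<eta> (\<lambda>x. h (A x)) X"
  shows "\<bar>image_fun d X y - \<eta> * h (A y)\<bar> \<le> 4 * C\<^sub>L * C\<^sub>A * (\<eta> * L1_norm_unit h) / real d"
proof -
  have "\<bar>image_fun d X y - \<eta> * h (A y)\<bar> \<le> \<eta> * (C\<^sub>L * L1_norm_unit h * (2 * C\<^sub>A)) * (2 / real d)"
    using CL_pos CA_pos admissible_L1_pos[OF adm]
    by (intro pixel_average_close[OF d admissible_comp_lip[OF adm A]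
          admissible_comp_support[OF adm A] \<eta> _ X]) auto
  then show ?thesis by (simp add: mult_ac)
qed

text \<open>Normalization divides the error by the \<open>L\<^sup>2\<close> norm of the target, which is at least
  \<open>lower_const\<close> times its \<open>L\<^sup>1\<close> norm.\<close>

lemma normalized_close:
  assumes adm: "admissible h" and A: "A \<in> \<A>" "A2 \<in> \<A>" "A1 \<in> \<A>" and d: "1 \<le> d"
    and \<eta>: "0 < \<eta>" and "0 < c"
    and close: "\<And>x. \<bar>image_fun d X (inv A2 x) - \<eta> * h (A (inv A1 x))\<bar>
        \<le> c * (4 * C\<^sub>L * C\<^sub>A * (\<eta> * L1_norm_unit h) / real d)"
  defines "v \<equiv> \<lambda>x. h (A (inv A1 x))"
  shows "L2_norm (\<lambda>x. normalized d X (inv A2) x - v x / L2_norm v) \<le> c * approx_const / real d"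
    and "sq_int (normalized d X (inv A2))"
proof -
  define N where "N = L1_norm_unit h"
  have N: "0 < N" using admissible_L1_pos[OF adm] by (simp add: N_def)
  define u where "u x = image_fun d X (inv A2 x)" for x
  define w where "w x = \<eta> * v x" for x
  define e where "e = c * (4 * C\<^sub>L * C\<^sub>A * (\<eta> * N) / real d)"
  have e: "\<bar>u x - w x\<bar> \<le> e" for x
    using close[of x] by (simp add: u_def w_def v_def e_def N_def)
  have v_sq: "sq_int v"
    unfolding v_def by (rule admissible_comp_sq_int(1)[OF adm A(1,3)])
  have w_sq: "sq_int w"
    using sq_int_scale[OF v_sq, of \<eta>] by (simp add: w_def[abs_def])
  have u_meas: "u \<in> borel_measurable borel"
    unfolding u_def[abs_def]
    by (rule measurable_compose[OF deformation_borel(2)[OF A(2)] image_fun_borel])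
  have supp: "x \<in> covering_domain C\<^sub>A" if "u x - w x \<noteq> 0" for x
  proof -
    from that consider "u x \<noteq> 0" | "w x \<noteq> 0" by fastforce
    then show ?thesis
    proof cases
      case 1
      then show ?thesis
        using image_fun_support[OF d] inv_mem_unit_square[OF A(2)] by (auto simp: u_def)
    next
      case 2
      then have "h (A (inv A1 x)) \<noteq> 0" by (simp add: w_def v_def)
      then show ?thesis
        by (rule inv_mem_unit_square[OF A(3) admissible_comp_support[OF adm A(1)]])
    qed
  qed
  have diff_meas: "(\<lambda>x. u x - w x) \<in> borel_measurable borel"
    using u_meas w_sq by (auto simp: sq_int_def)
  have diff_sq: "sq_int (\<lambda>x. u x - w x)" and diff_le: "L2_norm (\<lambda>x. u x - w x) \<le> e * side"
    unfolding side_def by (rule bounded_support_covering_domain[OF diff_meas e supp CA_pos]; assumption)+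
  have u_sq: "sq_int u" using sq_int_add[OF diff_sq w_sq] by simp
  have w_norm: "L2_norm w = \<eta> * L2_norm v"
    using L2_norm_scale[of \<eta> v] \<eta> by (simp add: w_def[abs_def])
  have v_lower: "lower_const * N \<le> L2_norm v"
    unfolding v_def N_def by (rule admissible_comp_L2_lower[OF adm A(1,3)])
  then have w_lower: "\<eta> * (lower_const * N) \<le> L2_norm w"
    unfolding w_norm using \<eta> by (intro mult_left_mono) auto
  have pos: "0 < \<eta> * (lower_const * N)" using \<eta> lower_const_pos N by simp
  have normalized_eq: "normalized d X (inv A2) = (\<lambda>x. u x / L2_norm u)"
    by (simp add: fun_eq_iff normalized_def u_def[abs_def] comp_def)
  have "L2_norm (\<lambda>x. normalized d X (inv A2) x - v x / L2_norm v)
      = L2_norm (\<lambda>x. u x / L2_norm u - w x / L2_norm w)"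
    using \<eta> by (simp add: normalized_eq w_norm w_def)
  also have "\<dots> \<le> 2 * L2_norm (\<lambda>x. u x - w x) / L2_norm w"
    using w_lower pos by (intro L2_norm_normalize_diff u_sq w_sq) auto
  also have "\<dots> \<le> 2 * (e * side) / (\<eta> * (lower_const * N))"
    using diff_le w_lower pos L2_norm_nonneg[of "\<lambda>x. u x - w x"] by (intro frac_le) linarith+
  \<comment> \<open>Brightness and \<open>L1_norm_unit\<close> cancel, so the rate depends on
    neither the image nor the template.\<close>
  also have "\<dots> = c * approx_const / real d"
    using \<eta> N lower_const_pos by (simp add: e_def approx_const_def field_simps)
  finally show "L2_norm (\<lambda>x. normalized d X (inv A2) x - v x / L2_norm v) \<le> c * approx_const / real d" .
  show "sq_int (normalized d X (inv A2))"
    using sq_int_scale[OF u_sq, of "1 / L2_norm u"] by (simp add: normalized_eq)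
qed

text \<open>Image and target are composed with the same inverse map, which need not match
  \<open>A\<close>; only the pixel error enters, so \<open>c\<close> is 1.\<close>

lemma normalized_deformed_close:
  assumes adm: "admissible h" and A: "A \<in> \<A>" "A2 \<in> \<A>" and d: "1 \<le> d" and \<eta>: "0 < \<eta>"
    and X: "pixel_sampling d \<eta> (\<lambda>x. h (A x)) X"
  shows "L2_norm (\<lambda>x. normalized d X (inv A2) x
      - h (A (inv A2 x)) / L2_norm (\<lambda>x. h (A (inv A2 x)))) \<le> approx_const / real d"
    and "sq_int (normalized d X (inv A2))"
  using normalized_close[OF adm A A(2) d \<eta> zero_less_one] image_comp_approx[OF adm A(1) d \<eta> X]
  by simp_all

lemma covering_close:
  assumes "is_covering d (covering_domain C\<^sub>A) \<A> \<B>" and A: "A \<in> \<A>"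
  obtains A2 where "A2 \<in> \<A>" "inv A2 \<in> \<B>"
    "\<And>x. x \<in> covering_domain C\<^sub>A \<Longrightarrow> l1 (inv A x - inv A2 x) \<le> 2 / real d"
proof -
  obtain B where B: "B \<in> \<B>" "Linf_norm_on (covering_domain C\<^sub>A) (\<lambda>z. inv A z - B z) \<le> 1 / real d"
    using assms unfolding is_covering_def by blast
  then obtain A2 where A2: "A2 \<in> \<A>" "B = inv A2"
    using assms(1) unfolding is_covering_def by blast
  have close: "\<bar>(inv A x - inv A2 x) $ i\<bar> \<le> 1 / real d" if x: "x \<in> covering_domain C\<^sub>A" for x i
  proof -
    have "continuous_on UNIV (\<lambda>z. \<bar>(inv A z - inv A2 z) $ i\<bar>)"
      using deformation_continuous(2)[OF A] deformation_continuous(2)[OF A2(1)]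
      by (intro continuous_intros)
    \<comment> \<open>A real supremum bounds the values only if they are bounded above; compactness
      of the domain ensures this.\<close>
    then have "compact ((\<lambda>z. \<bar>(inv A z - inv A2 z) $ i\<bar>) ` covering_domain C\<^sub>A)"
      unfolding covering_domain_eq_cbox
      using continuous_on_subset by (intro compact_continuous_image) auto
    then have "bdd_above ((\<lambda>z. \<bar>(inv A z - inv A2 z) $ i\<bar>) ` covering_domain C\<^sub>A)"
      by (intro bounded_imp_bdd_above compact_imp_bounded)
    then have "\<bar>(inv A x - inv A2 x) $ i\<bar> \<le> (SUP z\<in>covering_domain C\<^sub>A. \<bar>(inv A z - inv A2 z) $ i\<bar>)"
      by (rule cSUP_upper[OF x])
    also have "\<dots> \<le> Linf_norm_on (covering_domain C\<^sub>A) (\<lambda>z. inv A z - inv A2 z)"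
      using exhaust_2[of i] by (auto simp: Linf_norm_on_def)
    finally show ?thesis using B(2) A2(2) by simp
  qed
  have "l1 (inv A x - inv A2 x) \<le> 2 / real d" if "x \<in> covering_domain C\<^sub>A" for x
    using close[OF that, of 1] close[OF that, of 2] unfolding l1_def by linarith
  with A2 B(1) show ?thesis by (intro that) auto
qed

text \<open>Here the target is \<open>h\<close> itself. Pixel error and covering error obey the same
  bound, so \<open>normalized_close\<close> applies with \<open>c = 2\<close> and the identity for
  both target maps.\<close>

lemma normalized_aligned_close:
  assumes cov: "is_covering d (covering_domain C\<^sub>A) \<A> \<B>"
    and adm: "admissible h" and A: "A \<in> \<A>" and d: "1 \<le> d" and \<eta>: "0 < \<eta>"
    and X: "pixel_sampling d \<eta> (\<lambda>x. h (A x)) X"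
  obtains B where "B \<in> \<B>" "L2_norm (\<lambda>x. normalized d X B x - h x / L2_norm h) \<le> 2 * approx_const / real d"
    "sq_int (normalized d X B)"
proof -
  obtain A2 where A2: "A2 \<in> \<A>" "inv A2 \<in> \<B>" and
    cl: "\<And>x. x \<in> covering_domain C\<^sub>A \<Longrightarrow> l1 (inv A x - inv A2 x) \<le> 2 / real d"
    using covering_close[OF cov A] by blast
  define N where "N = L1_norm_unit h"
  have N: "0 < N" using admissible_L1_pos[OF adm] by (simp add: N_def)
  have h_close: "\<bar>h (A (inv A2 x)) - h x\<bar> \<le> 4 * C\<^sub>L * C\<^sub>A * N / real d" for x
  proof (cases "x \<in> covering_domain C\<^sub>A")
    case True
    have "\<bar>h (A (inv A2 x)) - h x\<bar> = \<bar>h (A (inv A x)) - h (A (inv A2 x))\<bar>"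
      using A by (simp add: abs_minus_commute)
    also have "\<dots> \<le> C\<^sub>L * N * (2 * C\<^sub>A) * l1 (inv A x - inv A2 x)"
      unfolding N_def by (rule admissible_comp_lip[OF adm A])
    also have "\<dots> \<le> C\<^sub>L * N * (2 * C\<^sub>A) * (2 / real d)"
      using CL_pos CA_pos N by (intro mult_left_mono cl True) auto
    finally show ?thesis by (simp add: mult_ac)
  next
    case False
    \<comment> \<open>The covering gives no control here, but both terms vanish off the covering
      domain.\<close>
    then have "h x = 0"
      using admissible_support[OF adm, of x] R_subset unit_square_subset by blast
    moreover have "h (A (inv A2 x)) = 0"
      using False inv_mem_unit_square[OF A2(1)] admissible_comp_support[OF adm A, of "inv A2 x"] by blast
    ultimately show ?thesis using CL_pos CA_pos N by simp
  qed
  have "\<bar>image_fun d X (inv A2 x) - \<eta> * h (id (inv id x))\<bar>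
      \<le> 2 * (4 * C\<^sub>L * C\<^sub>A * (\<eta> * L1_norm_unit h) / real d)" for x
  proof -
    have "\<bar>\<eta> * h (A (inv A2 x)) - \<eta> * h x\<bar> = \<eta> * \<bar>h (A (inv A2 x)) - h x\<bar>"
      using \<eta> by (simp add: abs_mult flip: right_diff_distrib)
    also have "\<dots> \<le> \<eta> * (4 * C\<^sub>L * C\<^sub>A * N / real d)"
      using \<eta> by (intro mult_left_mono h_close) auto
    also have "\<dots> = 4 * C\<^sub>L * C\<^sub>A * (\<eta> * L1_norm_unit h) / real d"
      by (simp add: N_def mult_ac)
    finally show ?thesis
      using image_comp_approx[OF adm A d \<eta> X, of "inv A2 x"] unfolding inv_id id_apply by linarith
  qed
  from normalized_close[OF adm id_mem A2(1) id_mem d \<eta> zero_less_numeral this]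
  show ?thesis by (intro that[OF A2(2)]) (simp_all add: inv_id)
qed


section \<open>Small discrepancy bounds the separation; correctness of the classifier\<close>

definition separation_const :: real where
  "separation_const = 12 * approx_const * C\<^sub>L * side / lower_const"

lemma separation_dir_le:
  assumes h: "admissible h" and g: "admissible g"
    and A: "A \<in> \<A>" "A2 \<in> \<A>" and A': "A' \<in> \<A>" "A4 \<in> \<A>" and d: "1 \<le> d"
    and \<eta>: "0 < \<eta>" "0 < \<eta>'"
    and X: "pixel_sampling d \<eta> (\<lambda>x. h (A x)) X"
    and Y: "pixel_sampling d \<eta>' (\<lambda>x. g (A' x)) Y"
    and close: "L2_norm (\<lambda>x. normalized d X (inv A2) x - normalized d Y (inv A4) x)
        \<le> 4 * approx_const / real d"
  shows "separation_dir \<A> h g \<le> separation_const / real d"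
proof -
  define p q where "p x = h (A (inv A2 x))" and "q x = g (A' (inv A4 x))" for x
  define TX TY where "TX = normalized d X (inv A2)" and "TY = normalized d Y (inv A4)"
  have p_pos: "0 < L2_norm p" and q_pos: "0 < L2_norm q"
    unfolding p_def[abs_def] q_def[abs_def]
    by (rule admissible_comp_L2_pos[OF h A] admissible_comp_L2_pos[OF g A'])+
  have sq: "sq_int TX" "sq_int TY" "sq_int p" "sq_int q"
    unfolding p_def[abs_def] q_def[abs_def] TX_def TY_def
    by (rule normalized_deformed_close(2)[OF h A d \<eta>(1) X] normalized_deformed_close(2)[OF g A' d \<eta>(2) Y]
        admissible_comp_sq_int(1)[OF h A] admissible_comp_sq_int(1)[OF g A']; assumption)+
  have sq': "sq_int (\<lambda>x. p x / L2_norm p)" "sq_int (\<lambda>x. q x / L2_norm q)"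
    using sq_int_scale[OF sq(3), of "1 / L2_norm p"] sq_int_scale[OF sq(4), of "1 / L2_norm q"] by simp_all
  have "L2_norm (\<lambda>x. TX x - p x / L2_norm p) \<le> approx_const / real d"
    unfolding p_def[abs_def] TX_def by (rule normalized_deformed_close(1)[OF h A d \<eta>(1) X])
  moreover have "L2_norm (\<lambda>x. TY x - q x / L2_norm q) \<le> approx_const / real d"
    unfolding q_def[abs_def] TY_def by (rule normalized_deformed_close(1)[OF g A' d \<eta>(2) Y])
  moreover have "L2_norm (\<lambda>x. TX x - TY x) \<le> 4 * (approx_const / real d)"
    using close by (simp add: TX_def TY_def)
  moreover note L2_norm_diff_triangle[OF sq'(1) sq(1) sq'(2)] L2_norm_diff_triangle[OF sq(1,2) sq'(2)]
  \<comment> \<open>The 6 is 1 + 4 + 1: the assumed discrepancy and one template approximation on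
    each side.\<close>
  ultimately have pq: "L2_norm (\<lambda>x. p x / L2_norm p - q x / L2_norm q) \<le> 6 * approx_const / real d"
    using L2_norm_minus_commute[of TX "\<lambda>x. p x / L2_norm p"] by simp
  \<comment> \<open>Multiplying by \<open>L2_norm q\<close> undoes the normalization of
    \<open>q\<close> and leaves this scalar in front of \<open>p\<close>, a competitor in the
    infimum.\<close>
  define a where "a = L2_norm q / L2_norm p"
  have "L2_norm (\<lambda>x. a * p x - q x) = L2_norm (\<lambda>x. L2_norm q * (p x / L2_norm p - q x / L2_norm q))"
    using q_pos by (simp add: a_def right_diff_distrib)
  also have "\<dots> = L2_norm q * L2_norm (\<lambda>x. p x / L2_norm p - q x / L2_norm q)"
    unfolding L2_norm_scale by simp
  also have "\<dots> \<le> (2 * C\<^sub>L * L1_norm_unit g * side) * (6 * approx_const / real d)"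
    using CL_pos admissible_L1_pos[OF g] side_pos
    by (intro mult_mono pq admissible_comp_sq_int(2)[OF g A', folded q_def[abs_def]]) auto
  finally have bound: "L2_norm (\<lambda>x. a * p x - q x)
      \<le> (2 * C\<^sub>L * L1_norm_unit g * side) * (6 * approx_const / real d)" .
  let ?S = "{L2_norm (\<lambda>x. a * (h \<circ> A1 \<circ> inv A2) x - (g \<circ> A3 \<circ> inv A4) x) | a A1 A2 A3 A4.
            A1 \<in> \<A> \<and> A2 \<in> \<A> \<and> A3 \<in> \<A> \<and> A4 \<in> \<A>}"
  have "L2_norm (\<lambda>x. a * p x - q x) \<in> ?S"
    unfolding p_def q_def using A A' by (fastforce simp: comp_def)
  moreover have "bdd_below ?S" by (rule bdd_belowI[of _ 0]) auto
  ultimately have "Inf ?S \<le> L2_norm (\<lambda>x. a * p x - q x)" by (rule cInf_lower)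
  also note bound
  finally have "separation_dir \<A> h g \<le>
      (2 * C\<^sub>L * L1_norm_unit g * side) * (6 * approx_const / real d) / L2_norm g"
    unfolding separation_dir_def by (intro divide_right_mono) auto
  \<comment> \<open>Numerator and denominator are now both proportional to
    \<open>L1_norm_unit g\<close>, which cancels.\<close>
  also have "\<dots> \<le> (2 * C\<^sub>L * L1_norm_unit g * side) * (6 * approx_const / real d)
      / (lower_const * L1_norm_unit g)"
    using CL_pos CA_pos side_pos lower_const_pos admissible_L1_pos[OF g] admissible_L2_lower[OF g]
    by (intro divide_left_mono) (auto simp: approx_const_def admissible_L2_pos[OF g])
  also have "\<dots> = separation_const / real d"
    using admissible_L1_pos[OF g] by (simp add: separation_const_def field_simps)
  finally show ?thesis .
qed

lemma finite_discrepancies: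
  assumes "finite \<B>"
  shows "finite {L2_norm (\<lambda>x. normalized d X B' x - normalized d Y B x) | B' B. B' \<in> \<B> \<and> B \<in> \<B>}"
  using assms by (intro finite_image_set2) auto

lemma generated_imageE:
  assumes "generated_image d f \<A> X k"
  obtains A \<eta> where "k = 0 \<or> k = 1" "A \<in> \<A>" "0 < \<eta>"
    "pixel_sampling d \<eta> (\<lambda>x. f k (A x)) X"
  using assms unfolding generated_image_def pixel_sampling_def by blast

text \<open>Both images can be aligned with the same normalized template, each up to
  \<open>2 * approx_const / d\<close>.\<close>

lemma same_label_discrepancy_le:
  assumes cov: "is_covering d (covering_domain C\<^sub>A) \<A> \<B>" and adm: "admissible (f k)" and d: "1 \<le> d"
    and X: "generated_image d f \<A> X k" and Y: "generated_image d f \<A> Y k"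
  shows "image_discrepancy d \<B> X Y \<le> 4 * approx_const / real d"
proof -
  define v where "v x = f k x / L2_norm (f k)" for x
  have sq: "sq_int v"
    using sq_int_scale[OF admissible_sq_int[OF adm], of "1 / L2_norm (f k)"] by (simp add: v_def[abs_def])
  have aligned: "\<exists>B\<in>\<B>. L2_norm (\<lambda>x. normalized d Z B x - v x) \<le> 2 * approx_const / real d
      \<and> sq_int (normalized d Z B)" if Z: "generated_image d f \<A> Z k" for Z
  proof -
    obtain A \<eta> where A: "A \<in> \<A>" "0 < \<eta>" and Z': "pixel_sampling d \<eta> (\<lambda>x. f k (A x)) Z"
      using generated_imageE[OF Z] by blast
    show ?thesis
      using normalized_aligned_close[OF cov adm A(1) d A(2) Z'] unfolding v_def by blast
  qed
  obtain B' where B': "B' \<in> \<B>" "L2_norm (\<lambda>x. normalized d X B' x - v x) \<le> 2 * approx_const / real d"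
      "sq_int (normalized d X B')"
    using aligned[OF X] by blast
  obtain B where B: "B \<in> \<B>" "L2_norm (\<lambda>x. normalized d Y B x - v x) \<le> 2 * approx_const / real d"
      "sq_int (normalized d Y B)"
    using aligned[OF Y] by blast
  have "finite \<B>" using cov by (simp add: is_covering_def)
  then have "image_discrepancy d \<B> X Y \<le> L2_norm (\<lambda>x. normalized d X B' x - normalized d Y B x)"
    unfolding image_discrepancy_def using B'(1) B(1) by (intro Min_le finite_discrepancies) auto
  also have "\<dots> \<le> 4 * approx_const / real d"
    using L2_norm_diff_triangle[OF B'(3) sq B(3)] B'(2) B(2)
      L2_norm_minus_commute[of v "normalized d Y B"] by simp
  finally show ?thesis .
qed

lemma classifier_correct:
  assumes cov: "is_covering d (covering_domain C\<^sub>A) \<A> \<B>" and d: "1 \<le> d"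
    and adm: "admissible (f 0)" "admissible (f 1)"
    and X: "generated_image d f \<A> X k"
    and Xs: "\<And>i. i \<in> {1..n} \<Longrightarrow> generated_image d f \<A> (Xs i) (ks i)"
    and labels: "{i\<in>{1..n}. ks i = 0} \<noteq> {}" "{i\<in>{1..n}. ks i = 1} \<noteq> {}"
    and sep: "separation_const / real d < separation \<A> (f 0) (f 1)"
    and classified: "inverse_mapping_classifier d \<B> n Xs ks X khat"
  shows "khat = k"
proof (rule ccontr)
  assume "khat \<noteq> k"
  obtain A \<eta> where A: "k = 0 \<or> k = 1" "A \<in> \<A>" "0 < \<eta>" and
    XA: "pixel_sampling d \<eta> (\<lambda>x. f k (A x)) X"
    using generated_imageE[OF X] by blast
  obtain i where i: "i \<in> {1..n}" "khat = ks i" and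
    min: "\<And>i'. i' \<in> {1..n} \<Longrightarrow> image_discrepancy d \<B> (Xs i) X \<le> image_discrepancy d \<B> (Xs i') X"
    using classified unfolding inverse_mapping_classifier_def is_arg_min_linorder by blast
  obtain A' \<eta>' where A': "khat = 0 \<or> khat = 1" "A' \<in> \<A>" "0 < \<eta>'" and
    YA: "pixel_sampling d \<eta>' (\<lambda>x. f khat (A' x)) (Xs i)"
    using generated_imageE[OF Xs[OF i(1)]] unfolding i(2) by blast
  obtain i' where i': "i' \<in> {1..n}" "ks i' = k" using labels A(1) by auto
  have adm_k: "admissible (f k)" and adm_khat: "admissible (f khat)" using adm A(1) A'(1) by auto
  have le: "image_discrepancy d \<B> (Xs i) X \<le> 4 * approx_const / real d"
    using min[OF i'(1)] same_label_discrepancy_le[OF cov adm_k d _ X] Xs[OF i'(1)] i'(2)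
    by (meson order_trans)
  let ?M = "{L2_norm (\<lambda>x. normalized d (Xs i) B' x - normalized d X B x) | B' B. B' \<in> \<B> \<and> B \<in> \<B>}"
  have \<B>: "finite \<B>" "\<B> \<subseteq> inv ` \<A>" using cov by (auto simp: is_covering_def)
  \<comment> \<open>Something must cover the inverse of the identity; hence the minimum is attained
    by actual members of the covering.\<close>
  moreover have "\<B> \<noteq> {}" using cov id_mem unfolding is_covering_def by blast
  ultimately have "Min ?M \<in> ?M" by (intro Min_in finite_discrepancies) auto
  then obtain B' B where B: "B' \<in> \<B>" "B \<in> \<B>"
    "image_discrepancy d \<B> (Xs i) X = L2_norm (\<lambda>x. normalized d (Xs i) B' x - normalized d X B x)"
    unfolding image_discrepancy_def by blast
  obtain A2 A4 where A24: "A2 \<in> \<A>" "B = inv A2" "A4 \<in> \<A>" "B' = inv A4"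
    using B \<B>(2) by blast
  have close: "L2_norm (\<lambda>x. normalized d (Xs i) (inv A4) x - normalized d X (inv A2) x)
      \<le> 4 * approx_const / real d"
    using le B(3) A24 by simp
  note close' = close[unfolded L2_norm_minus_commute[of "normalized d (Xs i) (inv A4)"]]
  have "separation_dir \<A> (f k) (f khat) \<le> separation_const / real d"
    by (rule separation_dir_le[OF adm_k adm_khat A(2) A24(1) A'(2) A24(3) d A(3) A'(3) XA YA close'])
  moreover have "separation_dir \<A> (f khat) (f k) \<le> separation_const / real d"
    by (rule separation_dir_le[OF adm_khat adm_k A'(2) A24(3) A(2) A24(1) d A'(3) A(3) YA XA close])
  \<comment> \<open>The two distinct labels are 0 and 1 in some order, and \<open>separation\<close>
    is a maximum, so both directions are needed.\<close>
  ultimately have "separation \<A> (f 0) (f 1) \<le> separation_const / real d"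
    using A(1) A'(1) \<open>khat \<noteq> k\<close> unfolding separation_def by auto
  with sep show False by simp
qed

end

section \<open>From the stated assumptions to uniform Lipschitz bounds\<close>

lemma assumptions_lipschitz_deformations:
  assumes bij: "\<And>A. A \<in> \<A> \<Longrightarrow> bij A"
    and templ: "template (f 0)"
    and ta: "template_assumption C\<^sub>L \<beta>\<^sub>l \<beta>\<^sub>r \<beta>\<^sub>d \<beta>\<^sub>u f"
    and da: "deformation_assumption C\<^sub>A C\<^sub>J \<beta>\<^sub>l \<beta>\<^sub>r \<beta>\<^sub>d \<beta>\<^sub>u \<A>"
  shows "lipschitz_deformations \<A> (rect \<beta>\<^sub>l \<beta>\<^sub>r \<beta>\<^sub>d \<beta>\<^sub>u) C\<^sub>L C\<^sub>A (8 * C\<^sub>A / C\<^sub>J\<^sup>2)"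
proof -
  have id_mem: "id \<in> \<A>" and CJ: "0 < C\<^sub>J" and CJ_eq: "C\<^sub>J\<^sup>2 = (INF A\<in>\<A>. INF x. \<bar>det (jacobian A x)\<bar>)"
    using da by (auto simp: deformation_assumption_def)
  have partial: "has_partial j (\<lambda>y. A y $ i) x" "continuous_on UNIV (partial_deriv j (\<lambda>y. A y $ i))"
    "\<bar>partial_deriv j (\<lambda>y. A y $ i) x\<bar> \<le> C\<^sub>A" if "A \<in> \<A>" for A i j x
    using da that by (auto simp: deformation_assumption_def)
  have det_ge: "C\<^sub>J\<^sup>2 \<le> \<bar>det (jacobian A x)\<bar>" if "A \<in> \<A>" for A x
  proof -
    \<comment> \<open>Infima of absolute values are nonnegative, so the nested infimum is a genuine
      lower bound.\<close>
    have "bdd_below ((\<lambda>A. INF x. \<bar>det (jacobian A x)\<bar>) ` \<A>)"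
      by (auto intro!: bdd_belowI[of _ 0] cINF_greatest)
    then have "C\<^sub>J\<^sup>2 \<le> (INF x. \<bar>det (jacobian A x)\<bar>)"
      unfolding CJ_eq using that by (rule cINF_lower)
    also have "\<dots> \<le> \<bar>det (jacobian A x)\<bar>"
      by (rule cINF_lower) (auto intro!: bdd_belowI[of _ 0])
    finally show ?thesis .
  qed
  \<comment> \<open>If it were 0, the Jacobian of the identity would vanish, contradicting the
    determinant bound.\<close>
  have "C\<^sub>A \<noteq> 0"
  proof
    assume "C\<^sub>A = 0"
    then have "det (jacobian id 0) = 0"
      using partial(3)[OF id_mem] by (simp add: det_2 jacobian_def)
    then show False using det_ge[OF id_mem, of 0] CJ by simp
  qed
  moreover have "0 \<le> C\<^sub>A" using partial(3)[OF id_mem, of 1 1 0] by linarith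
  ultimately have CA: "0 < C\<^sub>A" by simp
  show ?thesis
  proof
    show "\<bar>A x $ i - A y $ i\<bar> \<le> C\<^sub>A * l1 (x - y)" if "A \<in> \<A>" for A x y i
      using partial[OF that] by (intro partial_lipschitz)
    show "l1 (inv A x - inv A y) \<le> 8 * C\<^sub>A / C\<^sub>J\<^sup>2 * l1 (x - y)" if "A \<in> \<A>" for A x y
      by (rule inv_lipschitz) (use bij partial det_ge CJ that in auto)
    show "rect \<beta>\<^sub>l \<beta>\<^sub>r \<beta>\<^sub>d \<beta>\<^sub>u \<subseteq> A ` cbox 0 1" if "A \<in> \<A>" for A
      using da that by (auto simp: deformation_assumption_def)
    show "rect \<beta>\<^sub>l \<beta>\<^sub>r \<beta>\<^sub>d \<beta>\<^sub>u \<noteq> {}"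
      using templ ta unfolding template_def template_assumption_def by blast
  qed (use bij id_mem CA CJ ta in \<open>auto simp: template_assumption_def\<close>)
qed

theorem theorem3p1:
  fixes C\<^sub>L C\<^sub>A C\<^sub>J :: real
  shows "\<exists>C>0. \<forall>(d::nat) (n::nat) (f :: nat \<Rightarrow> real^2 \<Rightarrow> real) (\<A> :: deformation set)
      (\<B> :: deformation set) \<beta>\<^sub>l \<beta>\<^sub>r \<beta>\<^sub>d \<beta>\<^sub>u
      (Xs :: nat \<Rightarrow> image) (ks :: nat \<Rightarrow> nat) (X :: image) (k :: nat) (khat :: nat).
    d \<ge> 1 \<longrightarrow>
    template (f 0) \<longrightarrow> template (f 1) \<longrightarrow>
    (\<forall>A\<in>\<A>. bij A) \<longrightarrow>
    generated_image d f \<A> X k \<longrightarrow>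
    (\<forall>i\<in>{1..n}. generated_image d f \<A> (Xs i) (ks i)) \<longrightarrow>
    {i\<in>{1..n}. ks i = 0} \<noteq> {} \<longrightarrow>
    {i\<in>{1..n}. ks i = 1} \<noteq> {} \<longrightarrow>
    template_assumption C\<^sub>L \<beta>\<^sub>l \<beta>\<^sub>r \<beta>\<^sub>d \<beta>\<^sub>u f \<longrightarrow>
    deformation_assumption C\<^sub>A C\<^sub>J \<beta>\<^sub>l \<beta>\<^sub>r \<beta>\<^sub>d \<beta>\<^sub>u \<A> \<longrightarrow>
    is_covering d (covering_domain C\<^sub>A) \<A> \<B> \<longrightarrow>
    separation \<A> (f 0) (f 1) > C / real d \<longrightarrow>
    inverse_mapping_classifier d \<B> n Xs ks X khat \<longrightarrow>
    khat = k"
proof (intro exI conjI allI impI)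
  \<comment> \<open>Outside its locale the constant is a function of the three real parameters
    alone, so it can be fixed before the images, templates and deformations. The maximum with 1
    makes the witness positive for all parameter values.\<close>
  let ?c = "lipschitz_deformations.separation_const C\<^sub>L C\<^sub>A (8 * C\<^sub>A / C\<^sub>J\<^sup>2)"
  show "0 < max 1 ?c" by simp
  fix d n f \<A> \<B> \<beta>\<^sub>l \<beta>\<^sub>r \<beta>\<^sub>d \<beta>\<^sub>u Xs ks X k khat
  assume d: "1 \<le> (d::nat)" and templ: "template (f 0)" "template (f 1)" and bij: "\<forall>A\<in>\<A>. bij A"
    and X: "generated_image d f \<A> X k" and Xs: "\<forall>i\<in>{1..n}. generated_image d f \<A> (Xs i) (ks i)"
    and labels: "{i\<in>{1..n}. ks i = 0} \<noteq> {}" "{i\<in>{1..n}. ks i = 1} \<noteq> {}"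
    and ta: "template_assumption C\<^sub>L \<beta>\<^sub>l \<beta>\<^sub>r \<beta>\<^sub>d \<beta>\<^sub>u f"
    and da: "deformation_assumption C\<^sub>A C\<^sub>J \<beta>\<^sub>l \<beta>\<^sub>r \<beta>\<^sub>d \<beta>\<^sub>u \<A>"
    and cov: "is_covering d (covering_domain C\<^sub>A) \<A> \<B>"
    and sep: "max 1 ?c / real d < separation \<A> (f 0) (f 1)"
    and classified: "inverse_mapping_classifier d \<B> n Xs ks X khat"
  interpret lipschitz_deformations \<A> "rect \<beta>\<^sub>l \<beta>\<^sub>r \<beta>\<^sub>d \<beta>\<^sub>u" C\<^sub>L C\<^sub>A "8 * C\<^sub>A / C\<^sub>J\<^sup>2"
    using bij templ ta da by (intro assumptions_lipschitz_deformations) auto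
  have adm: "admissible (f 0)" "admissible (f 1)"
    using templ ta by (auto simp: admissible_def template_assumption_def l1_def)
  have "?c / real d \<le> max 1 ?c / real d" by (intro divide_right_mono) auto
  with sep have "?c / real d < separation \<A> (f 0) (f 1)" by linarith
  from classifier_correct[OF cov d adm X _ labels this classified] Xs
  show "khat = k" by blast
qed

end
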